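(* $\mathcal P=\mathbb C[M]\cdot e^{-r^2}$, with the actions $d\pi$ of $\mathfrak g$ and $\pi|_K$ of $K$, is a $(\mathfrak g,K)$-module in the sense of Harish-Chandra and Lepowsky.
   Context: $G\subset \mathrm{GL}(n,\mathbb R)$ is a real linear algebraic group (a closed subgroup of $\mathrm{GL}(n,\mathbb R)$), stable under transpose (hence real reductive), with Lie algebra $\mathfrak g\subset M_n(\mathbb R)$; $K$ is a maximal compact subgroup of $G$. $M\subset\mathbb R^n$ is a smooth real affine algebraic variety on which $G$ acts regularly; the action on $M\subset\mathbb R^n$ is by matrices. $\mathrm C_0(M)$ is the Banach space of continuous complex valued functions on $M$ vanishing at infinity, with the supremum norm, $(\pi(g)\varphi)(m)=\varphi(g^{-1}m)$ for $g\in G$, and $d\pi(X)\varphi=\frac{d}{dh}\pi(e^{hX})\varphi|_{h=0}$ for $X\in\mathfrak g$. $\mathbb C[M]$ is the ring of all functions on $M$ obtained by restricting complex polynomials on $\mathbb R^n$ to $M$, and $r^2(m)=m_1^2+\dots+m_n^2$, where coordinates are chosen so that $r^2$ is invariant under $K$. A $(\mathfrak g,K)$-module is a complex vector space $V$ which is a $\mathfrak g$-module and a $K$-module such that: (i) $k\cdot(X\cdot v)=(\mathrm{Ad}(k)X)\cdot(k\cdot v)$ for $k\in K$, $X\in\mathfrak g$, $v\in V$; (ii) for each $v\in V$ the span of $K\cdot v$ is finite dimensional and $K$ acts continuously on it; (iii) for $Y$ in the Lie algebra of $K$ and $v\in V$, $\frac{d}{dt}(e^{tY}\cdot v)|_{t=0}=Y\cdot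 v$. *)

theory Defs
  imports
    "HOL-Analysis.Analysis"
    "HOL-Library.Function_Algebras"
    "HOL-Algebra.Group"
begin

section \<open>Real linear algebraic groups and their Lie algebras\<close>

definition algebraic_set :: "'a::real_normed_vector set \<Rightarrow> bool" where
  "algebraic_set Z \<longleftrightarrow>
     (\<exists>S. (\<forall>p\<in>S. real_polynomial_function p) \<and> Z = {x. \<forall>p\<in>S. p x = 0})"

definition GL :: "(real^'n^'n) monoid" where
  "GL = \<lparr>carrier = {A. invertible A}, mult = (**), one = mat 1\<rparr>"

text \<open>Zariski closed subgroups of the general linear group.  Polynomials in the matrix entries
  and the inverse of the determinant have the same zero sets in the general linear group as
  polynomials in the matrix entries alone.\<close>

definition real_linear_algebraic_group :: "(real^'n^'n) set \<Rightarrow> bool" where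
  "real_linear_algebraic_group G \<longleftrightarrow>
     subgroup G GL \<and> (\<exists>Z. algebraic_set Z \<and> G = Z \<inter> carrier GL)"

definition maximal_compact_subgroup :: "(real^'n^'n) set \<Rightarrow> (real^'n^'n) set \<Rightarrow> bool" where
  "maximal_compact_subgroup K G \<longleftrightarrow>
     subgroup K GL \<and> K \<subseteq> G \<and> compact K \<and>
     (\<forall>L. subgroup L GL \<and> L \<subseteq> G \<and> compact L \<and> K \<subseteq> L \<longrightarrow> L = K)"

text \<open>The overloaded \<open>exp\<close> is not available here: multiplication on the type of matrices is
  componentwise.\<close>

definition mexp :: "real^'n^'n \<Rightarrow> real^'n^'n" where
  "mexp A = (\<Sum>k. (1 / fact k) *\<^sub>R (((**) A ^^ k) (mat 1)))"

definition lie_algebra :: "(real^'n^'n) set \<Rightarrow> (real^'n^'n) set" where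
  "lie_algebra G = {X. \<forall>t::real. mexp (t *\<^sub>R X) \<in> G}"

definition lie_bracket :: "real^'n^'n \<Rightarrow> real^'n^'n \<Rightarrow> real^'n^'n" where
  "lie_bracket X Y = X ** Y - Y ** X"

definition Ad :: "real^'n^'n \<Rightarrow> real^'n^'n \<Rightarrow> real^'n^'n" where
  "Ad k X = k ** X ** matrix_inv k"


section \<open>Smooth real affine varieties\<close>

text \<open>Jacobian criterion: near each of its points \<open>m\<close>, on the Zariski neighbourhood where \<open>h\<close>
  does not vanish, \<open>M\<close> is cut out by finitely many polynomials vanishing on \<open>M\<close> whose
  differentials at \<open>m\<close> are linearly independent (as a family indexed by \<open>F\<close>).\<close>

definition smooth_affine_variety :: "(real^'n) set \<Rightarrow> bool" where
  "smooth_affine_variety M \<longleftrightarrow>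
     algebraic_set M \<and>
     (\<forall>m\<in>M. \<exists>F h. finite F \<and> (\<forall>p\<in>F. real_polynomial_function p \<and> (\<forall>x\<in>M. p x = 0)) \<and>
        real_polynomial_function h \<and> h m \<noteq> 0 \<and>
        (\<forall>x. h x \<noteq> 0 \<longrightarrow> (x \<in> M \<longleftrightarrow> (\<forall>p\<in>F. p x = 0))) \<and>
        (\<forall>c. (\<forall>v. (\<Sum>p\<in>F. c p * frechet_derivative p (at m) v) = 0) \<longrightarrow> (\<forall>p\<in>F. c p = 0)))"


section \<open>The representation on continuous functions vanishing at infinity\<close>

text \<open>A function on \<open>M\<close> is represented by its extension by zero to the ambient space, so that
  functions on \<open>M\<close> form a subspace of the pointwise complex vector space of all functions.\<close>

definition fscale :: "complex \<Rightarrow> ('a \<Rightarrow> complex) \<Rightarrow> 'a \<Rightarrow> complex" where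
  "fscale c f = (\<lambda>x. c * f x)"

definition C0 :: "(real^'n) set \<Rightarrow> (real^'n \<Rightarrow> complex) set" where
  "C0 M = {f. (\<forall>x. x \<notin> M \<longrightarrow> f x = 0) \<and> continuous_on M f \<and>
              (\<forall>\<epsilon>>0. compact {m\<in>M. \<epsilon> \<le> cmod (f m)})}"

text \<open>Inserting 0 only matters when \<open>M\<close> is empty.\<close>

definition sup_norm :: "(real^'n) set \<Rightarrow> (real^'n \<Rightarrow> complex) \<Rightarrow> real" where
  "sup_norm M f = Sup (insert 0 ((\<lambda>m. cmod (f m)) ` M))"

text \<open>If \<open>M\<close> is stable under \<open>g\<close> and its inverse, translation by \<open>g\<close> preserves vanishing
  outside \<open>M\<close>.\<close>

definition translate :: "real^'n^'n \<Rightarrow> (real^'n \<Rightarrow> complex) \<Rightarrow> real^'n \<Rightarrow> complex" where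
  "translate g f = (\<lambda>m. f (matrix_inv g *v m))"

definition has_dpi ::
    "(real^'n) set \<Rightarrow> real^'n^'n \<Rightarrow> (real^'n \<Rightarrow> complex) \<Rightarrow> (real^'n \<Rightarrow> complex) \<Rightarrow> bool" where
  "has_dpi M X f f' \<longleftrightarrow> f' \<in> C0 M \<and>
     ((\<lambda>h::real. sup_norm M
         (fscale (1 / complex_of_real h) (translate (mexp (h *\<^sub>R X)) f - f) - f')) \<longlongrightarrow> 0) (at 0)"

definition dpi ::
    "(real^'n) set \<Rightarrow> real^'n^'n \<Rightarrow> (real^'n \<Rightarrow> complex) \<Rightarrow> (real^'n \<Rightarrow> complex)" where
  "dpi M X f = (THE f'. has_dpi M X f f')"

definition r2 :: "real^'n \<Rightarrow> real" where
  "r2 m = (\<Sum>i\<in>UNIV. (m $ i)\<^sup>2)"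

text \<open>A function into the complex numbers satisfies \<open>polynomial_function\<close> iff its real and
  imaginary parts are real polynomials, i.e. iff it is a polynomial with complex coefficients.\<close>

definition polynomial_ring_on :: "(real^'n) set \<Rightarrow> (real^'n \<Rightarrow> complex) set" where
  "polynomial_ring_on M = {\<lambda>m. if m \<in> M then p m else 0 | p. polynomial_function p}"

definition gauss_polynomials :: "(real^'n) set \<Rightarrow> (real^'n \<Rightarrow> complex) set" where
  "gauss_polynomials M =
     {\<lambda>m. f m * complex_of_real (exp (- r2 m)) | f. f \<in> polynomial_ring_on M}"


section \<open>Harish-Chandra modules\<close>

text \<open>The weak topology on a subspace \<open>W\<close>.  Linear functionals on \<open>W\<close> extend to the ambient
  space; hence, for finite-dimensional \<open>W\<close>, this is the unique Hausdorff vector space topology.\<close>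

definition fin_dim_topology :: "(complex \<Rightarrow> 'v \<Rightarrow> 'v::ab_group_add) \<Rightarrow> 'v set \<Rightarrow> 'v topology" where
  "fin_dim_topology sc W =
     topology_generated_by
       {{w\<in>W. f w \<in> U} | f U. Vector_Spaces.linear sc (*) f \<and> open (U :: complex set)}"

definition complex_linear_on ::
    "(complex \<Rightarrow> 'v \<Rightarrow> 'v::ab_group_add) \<Rightarrow> 'v set \<Rightarrow> ('v \<Rightarrow> 'v) \<Rightarrow> bool" where
  "complex_linear_on sc V T \<longleftrightarrow>
     T ` V \<subseteq> V \<and> (\<forall>v\<in>V. \<forall>w\<in>V. T (v + w) = T v + T w) \<and>
     (\<forall>c. \<forall>v\<in>V. T (sc c v) = sc c (T v))"

text \<open>\<open>\<gg>\<close> is a real Lie algebra of matrices and \<open>K\<close> a matrix group with Lie algebra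
  contained in \<open>\<gg>\<close>; \<open>a X\<close> and \<open>\<rho> k\<close> are the operators by which \<open>X \<in> \<gg>\<close> and \<open>k \<in> K\<close> act
  on the subspace \<open>V\<close> of the ambient complex vector space.\<close>

locale gK_module = vector_space sc
  for sc :: "complex \<Rightarrow> 'v \<Rightarrow> 'v::ab_group_add" +
  fixes \<gg> K :: "(real^'n^'n) set"
    and V :: "'v set"
    and a :: "real^'n^'n \<Rightarrow> 'v \<Rightarrow> 'v"
    and \<rho> :: "real^'n^'n \<Rightarrow> 'v \<Rightarrow> 'v"
  assumes V_subspace: "subspace V"
    and a_linear: "X \<in> \<gg> \<Longrightarrow> complex_linear_on sc V (a X)"
    and a_add: "\<lbrakk>X \<in> \<gg>; Y \<in> \<gg>; v \<in> V\<rbrakk> \<Longrightarrow> a (X + Y) v = a X v + a Y v"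
    and a_scaleR: "\<lbrakk>X \<in> \<gg>; v \<in> V\<rbrakk> \<Longrightarrow> a (t *\<^sub>R X) v = sc (complex_of_real t) (a X v)"
    and a_bracket:
      "\<lbrakk>X \<in> \<gg>; Y \<in> \<gg>; v \<in> V\<rbrakk> \<Longrightarrow> a (lie_bracket X Y) v = a X (a Y v) - a Y (a X v)"
    and rho_linear: "k \<in> K \<Longrightarrow> complex_linear_on sc V (\<rho> k)"
    and rho_one: "v \<in> V \<Longrightarrow> \<rho> (mat 1) v = v"
    and rho_mult: "\<lbrakk>k \<in> K; l \<in> K; v \<in> V\<rbrakk> \<Longrightarrow> \<rho> (k ** l) v = \<rho> k (\<rho> l v)"
    and compatible: "\<lbrakk>k \<in> K; X \<in> \<gg>; v \<in> V\<rbrakk> \<Longrightarrow> \<rho> k (a X v) = a (Ad k X) (\<rho> k v)"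
    and K_finite: "v \<in> V \<Longrightarrow> \<exists>B. finite B \<and> span B = span ((\<lambda>k. \<rho> k v) ` K)"
    and K_continuous:
      "\<lbrakk>v \<in> V; W = span ((\<lambda>k. \<rho> k v) ` K)\<rbrakk> \<Longrightarrow>
         continuous_map (prod_topology (top_of_set K) (fin_dim_topology sc W))
           (fin_dim_topology sc W) (\<lambda>(k, w). \<rho> k w)"
    and K_differential:
      "\<lbrakk>Y \<in> lie_algebra K; v \<in> V\<rbrakk> \<Longrightarrow>
         limitin (fin_dim_topology sc (span ((\<lambda>k. \<rho> k v) ` K)))
           (\<lambda>t::real. sc (1 / complex_of_real t) (\<rho> (mexp (t *\<^sub>R Y)) v - v)) (a Y v) (at 0)"

end

theory Submission
  imports Defs
begin

text \<open>On \<open>\<P>\<close> the operator \<open>d\<pi>(X)\<close> is minus the derivative along the linear vector field \<open>m \<mapsto> X m\<close>: the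
  second derivative of \<open>t \<mapsto> \<phi>(e\<^sup>-\<^sup>t\<^sup>X m)\<close> is again an element of \<open>\<P>\<close> evaluated along the flow, hence
  bounded uniformly in \<open>m\<close>, so Taylor's formula gives convergence of the difference quotients in the
  supremum norm. The bracket relation then is an identity between derivations of polynomials, provided
  that the Lie algebra of \<open>G\<close> is closed under sums (Lie product formula) and brackets (derivative of
  \<open>e\<^sup>s\<^sup>X Y e\<^sup>-\<^sup>s\<^sup>X\<close> in the closed subspace \<open>\<gg>\<close>). For the action of \<open>K\<close>, the Gaussian is invariant, and
  \<open>p(A m)\<close> is a finite sum \<open>\<Sum> c\<^sub>i(A) b\<^sub>i(m)\<close> with differentiable coefficients \<open>c\<^sub>i\<close>; this gives
  finiteness of orbits as well as weak continuity and differentiability.\<close>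

section \<open>Bounded operators as a Banach algebra\<close>

text \<open>The library's \<open>exp\<close> needs a type class instance of Banach algebras, which exists neither for matrices
  with the matrix product nor for bounded operators with composition.\<close>

typedef (overloaded) 'a endo = "UNIV :: ('a::real_normed_vector \<Rightarrow>\<^sub>L 'a) set"
  morphisms endo_blinfun Endo ..

setup_lifting type_definition_endo

instantiation endo :: ("{real_normed_vector, perfect_space}") real_normed_algebra_1
begin

lift_definition zero_endo :: "'a endo" is 0 .
lift_definition one_endo :: "'a endo" is id_blinfun .
lift_definition plus_endo :: "'a endo \<Rightarrow> 'a endo \<Rightarrow> 'a endo" is "(+)" .
lift_definition minus_endo :: "'a endo \<Rightarrow> 'a endo \<Rightarrow> 'a endo" is "(-)" .
lift_definition uminus_endo :: "'a endo \<Rightarrow> 'a endo" is uminus .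
lift_definition times_endo :: "'a endo \<Rightarrow> 'a endo \<Rightarrow> 'a endo" is "(o\<^sub>L)" .
lift_definition scaleR_endo :: "real \<Rightarrow> 'a endo \<Rightarrow> 'a endo" is scaleR .
lift_definition norm_endo :: "'a endo \<Rightarrow> real" is norm .

definition dist_endo :: "'a endo \<Rightarrow> 'a endo \<Rightarrow> real" where "dist_endo a b = norm (a - b)"

definition [code del]:
  "(uniformity :: ('a endo \<times> 'a endo) filter) = (INF e\<in>{0 <..}. principal {(x, y). dist x y < e})"

definition open_endo :: "'a endo set \<Rightarrow> bool"
  where [code del]: "open_endo S = (\<forall>x\<in>S. \<forall>\<^sub>F (x', y) in uniformity. x' = x \<longrightarrow> y \<in> S)"

definition sgn_endo :: "'a endo \<Rightarrow> 'a endo" where "sgn_endo x = scaleR (inverse (norm x)) x"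

instance
proof
  fix a b c :: "'a endo" and r s :: real
  show "norm (a * b) \<le> norm a * norm b"
    by transfer (rule norm_blinfun_compose)
  show "norm (1::'a endo) = 1"
    by transfer (rule norm_blinfun_id)
  have "norm (0::'a endo) = 0" by transfer simp
  then show "(0::'a endo) \<noteq> 1"
    using \<open>norm (1::'a endo) = 1\<close> by auto
  show "a * b * c = a * (b * c)" "1 * a = a" "a * 1 = a"
    by (transfer, rule blinfun_eqI, simp)+
  show "(a + b) * c = a * c + b * c" "a * (b + c) = a * b + a * c"
    "(r *\<^sub>R a) * b = r *\<^sub>R (a * b)" "a * (r *\<^sub>R b) = r *\<^sub>R (a * b)"
    by (transfer, rule blinfun_eqI, simp add: blinfun.bilinear_simps)+
  show "norm (a + b) \<le> norm a + norm b" "norm (r *\<^sub>R a) = \<bar>r\<bar> * norm a" "(norm a = 0) = (a = 0)"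
    by (transfer, simp add: norm_triangle_ineq)+
qed (unfold dist_endo_def open_endo_def sgn_endo_def uniformity_endo_def,
    (rule refl | (transfer, simp add: algebra_simps))+)

end

instance endo :: ("{banach, perfect_space}") banach
proof
  fix X :: "nat \<Rightarrow> 'a endo"
  have dist_eq: "dist (Endo f) (Endo g) = dist f g" for f g :: "'a \<Rightarrow>\<^sub>L 'a"
    unfolding dist_norm by (metis Endo_inverse UNIV_I minus_endo.abs_eq norm_endo.abs_eq)
  assume "Cauchy X"
  then have "Cauchy (\<lambda>n. endo_blinfun (X n))"
    unfolding Cauchy_def by (metis dist_eq endo_blinfun_inverse)
  then obtain l where "(\<lambda>n. endo_blinfun (X n)) \<longlonglongrightarrow> l"
    using Cauchy_convergent convergent_def by blast
  then have "X \<longlonglongrightarrow> Endo l"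
    unfolding lim_sequentially by (metis dist_eq endo_blinfun_inverse)
  then show "convergent X" by (rule convergentI)
qed

section \<open>Products of exponentials in a Banach algebra\<close>

lemma norm_power_diff_le:
  fixes a b :: "'a::real_normed_algebra_1"
  assumes "norm a \<le> m" "norm b \<le> m" "1 \<le> m"
  shows "norm (a ^ n - b ^ n) \<le> of_nat n * m ^ n * norm (a - b)"
proof (induction n)
  case (Suc n)
  have "norm b ^ n \<le> m ^ n"
    using assms by (intro power_mono) auto
  then have bn: "norm (b ^ n) \<le> m ^ Suc n"
    using assms norm_power_ineq[of b n] power_increasing[of n "Suc n" m] by linarith
  have "a ^ Suc n - b ^ Suc n = a * (a ^ n - b ^ n) + (a - b) * b ^ n"
    by (simp add: algebra_simps)
  also have "norm \<dots> \<le> norm a * norm (a ^ n - b ^ n) + norm (a - b) * norm (b ^ n)"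
    by (intro norm_triangle_le add_mono norm_mult_ineq)
  also have "\<dots> \<le> m * (of_nat n * m ^ n * norm (a - b)) + norm (a - b) * m ^ Suc n"
    using assms Suc bn by (intro add_mono mult_mono) auto
  finally show ?case by (simp add: algebra_simps)
qed simp

lemma exp_divide_power_eq_banach:
  fixes x :: "'a::{real_normed_algebra_1,banach}"
  assumes "n > 0"
  shows "exp ((1 / real n) *\<^sub>R x) ^ n = exp x"
proof -
  have "exp (real k *\<^sub>R y) = exp y ^ k" for k and y :: 'a
  proof (induction k)
    case (Suc k)
    have "real (Suc k) *\<^sub>R y = y + real k *\<^sub>R y" by (simp add: algebra_simps)
    then show ?case using Suc by (simp add: exp_add_commuting)
  qed simp
  from this[of n "(1 / real n) *\<^sub>R x"] show ?thesis using assms by simp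
qed

theorem lie_product_formula:
  fixes x y :: "'a::{real_normed_algebra_1,banach}"
  shows "(\<lambda>n. (exp ((1 / real n) *\<^sub>R x) * exp ((1 / real n) *\<^sub>R y)) ^ n) \<longlonglongrightarrow> exp (x + y)"
proof -
  define \<phi> where "\<phi> t = exp (t *\<^sub>R x) * exp (t *\<^sub>R y) - exp (t *\<^sub>R (x + y))" for t :: real
  define C where "C = norm x + norm y"
  have "(\<phi> has_vector_derivative
      exp (0 *\<^sub>R x) * (y * exp (0 *\<^sub>R y)) + (x * exp (0 *\<^sub>R x)) * exp (0 *\<^sub>R y)
      - (x + y) * exp (0 *\<^sub>R (x + y))) (at 0)"
    unfolding \<phi>_def
    by (intro has_vector_derivative_diff has_vector_derivative_mult exp_scaleR_has_vector_derivative_left)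
  then have "(\<phi> has_vector_derivative 0) (at 0)" by simp
  then have "((\<lambda>t. (1 / \<bar>t\<bar>) *\<^sub>R \<phi> t) \<longlongrightarrow> 0) (at 0)"
    by (subst tendsto_norm_zero_iff[symmetric])
      (simp add: has_vector_derivative_def has_derivative_at \<phi>_def)
  moreover have "filterlim (\<lambda>n. 1 / real n) (at 0) sequentially"
    by (auto simp: filterlim_at eventually_sequentially lim_1_over_n intro!: exI[of _ 1])
  ultimately have lim: "(\<lambda>n. (1 / \<bar>1 / real n\<bar>) *\<^sub>R \<phi> (1 / real n)) \<longlonglongrightarrow> 0"
    by (rule filterlim_compose)
  have bound: "norm ((exp ((1 / real n) *\<^sub>R x) * exp ((1 / real n) *\<^sub>R y)) ^ n - exp (x + y))
      \<le> exp C * norm ((1 / \<bar>1 / real n\<bar>) *\<^sub>R \<phi> (1 / real n))" if "n > 0" for n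
  proof -
    let ?a = "exp ((1 / real n) *\<^sub>R x) * exp ((1 / real n) *\<^sub>R y)"
    let ?b = "exp ((1 / real n) *\<^sub>R (x + y))"
    have "norm ?a \<le> exp (norm ((1 / real n) *\<^sub>R x)) * exp (norm ((1 / real n) *\<^sub>R y))"
      by (intro order_trans[OF norm_mult_ineq] mult_mono norm_exp) auto
    also have "\<dots> = exp (C / n)" by (simp add: C_def exp_add[symmetric] add_divide_distrib)
    finally have a: "norm ?a \<le> exp (C / n)" .
    have "norm ?b \<le> exp (norm ((1 / real n) *\<^sub>R (x + y)))" by (rule norm_exp)
    also have "\<dots> \<le> exp (C / n)"
      by (simp add: C_def norm_triangle_ineq divide_right_mono)
    finally have b: "norm ?b \<le> exp (C / n)" .
    have "norm (?a ^ n - ?b ^ n) \<le> of_nat n * exp (C / n) ^ n * norm (?a - ?b)"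
      using a b by (intro norm_power_diff_le) (auto simp: C_def)
    also have "exp (C / n) ^ n = exp C"
      using that by (simp flip: exp_of_nat_mult)
    finally show ?thesis
      using that by (simp add: exp_divide_power_eq_banach \<phi>_def mult_ac)
  qed
  have "(\<lambda>n. (exp ((1 / real n) *\<^sub>R x) * exp ((1 / real n) *\<^sub>R y)) ^ n - exp (x + y)) \<longlonglongrightarrow> 0"
  proof (rule Lim_null_comparison)
    show "\<forall>\<^sub>F n in sequentially.
        norm ((exp ((1 / real n) *\<^sub>R x) * exp ((1 / real n) *\<^sub>R y)) ^ n - exp (x + y))
        \<le> exp C * norm ((1 / \<bar>1 / real n\<bar>) *\<^sub>R \<phi> (1 / real n))"
      using bound by (auto simp: eventually_sequentially intro!: exI[of _ 1])
    show "(\<lambda>n. exp C * norm ((1 / \<bar>1 / real n\<bar>) *\<^sub>R \<phi> (1 / real n))) \<longlonglongrightarrow> 0"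
      using tendsto_mult_right_zero[OF tendsto_norm_zero[OF lim]] .
  qed
  then show ?thesis by (simp add: LIM_zero_iff)
qed

lemma exp_conjugate:
  fixes u v x :: "'a::{real_normed_algebra_1,banach}"
  assumes "u * v = 1" "v * u = 1"
  shows "exp (u * x * v) = u * exp x * v"
proof -
  have pow: "(u * x * v) ^ n = u * x ^ n * v" for n
  proof (induction n)
    case (Suc n)
    have "(u * x * v) ^ Suc n = u * x * (v * u) * x ^ n * v"
      using Suc by (simp add: mult.assoc)
    then show ?case using assms by (simp add: mult.assoc)
  qed (simp add: assms)
  have "bounded_linear (\<lambda>z. u * z * v)"
    by (intro bounded_linear_mult_const bounded_linear_const_mult bounded_linear_ident)
  from bounded_linear.sums[OF this summable_sums[OF summable_exp_generic[of x]]]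
  have "(\<lambda>n. (u * x * v) ^ n /\<^sub>R fact n) sums (u * exp x * v)"
    by (simp add: pow exp_def)
  then show ?thesis by (simp add: exp_def sums_iff)
qed

section \<open>The matrix exponential\<close>

definition matrix_endo :: "real^'n^'n \<Rightarrow> (real^'n) endo" where
  "matrix_endo A = Endo (Blinfun ((*v) A))"

definition endo_matrix :: "(real^'n) endo \<Rightarrow> real^'n^'n" where
  "endo_matrix E = (\<chi> i j. blinfun_apply (endo_blinfun E) (axis j 1) $ i)"

lemma apply_matrix_endo [simp]: "blinfun_apply (endo_blinfun (matrix_endo A)) v = A *v v"
  by (simp add: matrix_endo_def Endo_inverse bounded_linear_Blinfun_apply
      linear_conv_bounded_linear[symmetric])

lemma endo_eqI: "(\<And>v. blinfun_apply (endo_blinfun E) v = blinfun_apply (endo_blinfun F) v) \<Longrightarrow> E = F"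
  by (simp add: blinfun_eqI endo_blinfun_inject[symmetric])

lemma matrix_endo_mult: "matrix_endo (A ** B) = matrix_endo A * matrix_endo B"
  by (rule endo_eqI) (simp add: times_endo.rep_eq matrix_vector_mul_assoc)

lemma matrix_endo_one: "matrix_endo (mat 1) = 1"
  by (rule endo_eqI) (simp add: one_endo.rep_eq)

lemma matrix_endo_power: "matrix_endo (((**) A ^^ k) (mat 1)) = matrix_endo A ^ k"
  by (induction k) (simp_all add: matrix_endo_mult matrix_endo_one)

lemma linear_matrix_endo: "linear matrix_endo"
  by (rule linearI; rule endo_eqI)
    (simp_all add: plus_endo.rep_eq scaleR_endo.rep_eq blinfun.bilinear_simps
      matrix_vector_mult_add_rdistrib scaleR_matrix_vector_assoc)

lemma matrix_endo_scaleR: "matrix_endo (t *\<^sub>R A) = t *\<^sub>R matrix_endo A"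
  by (rule linear_scale[OF linear_matrix_endo])

lemma endo_matrix_inverse [simp]: "endo_matrix (matrix_endo A) = A"
  by (simp add: endo_matrix_def vec_eq_iff matrix_vector_mult_basis column_def)

lemma matrix_endo_inverse [simp]: "matrix_endo (endo_matrix E) = E"
proof (rule endo_eqI)
  fix v
  have "matrix ((\<lambda>v. blinfun_apply (endo_blinfun E) v)) = endo_matrix E"
    by (simp add: endo_matrix_def matrix_def)
  moreover have "linear (\<lambda>v. blinfun_apply (endo_blinfun E) v)"
    by (simp add: bounded_linear.linear blinfun.bounded_linear_right)
  ultimately show "blinfun_apply (endo_blinfun (matrix_endo (endo_matrix E))) v
      = blinfun_apply (endo_blinfun E) v"
    using matrix_works[of "blinfun_apply (endo_blinfun E)" v]
    by (simp add: linear_matrix_vector_mul_eq)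
qed

lemma bounded_linear_endo_matrix: "bounded_linear endo_matrix"
proof (rule bounded_linear_intro[where K="real CARD('n) * real CARD('n)"])
  fix E F :: "(real^'n) endo" and r :: real
  show "endo_matrix (E + F) = endo_matrix E + endo_matrix F"
    "endo_matrix (r *\<^sub>R E) = r *\<^sub>R endo_matrix E"
    by (simp_all add: endo_matrix_def vec_eq_iff plus_endo.rep_eq scaleR_endo.rep_eq
        blinfun.bilinear_simps)
  have entry: "\<bar>endo_matrix E $ i $ j\<bar> \<le> norm E" for i j
  proof -
    have "\<bar>endo_matrix E $ i $ j\<bar> \<le> norm (blinfun_apply (endo_blinfun E) (axis j 1))"
      by (simp add: endo_matrix_def component_le_norm_cart)
    also have "\<dots> \<le> norm (endo_blinfun E) * norm (axis j (1::real) :: real^'n)"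
      by (rule norm_blinfun)
    finally show ?thesis by (simp add: norm_endo.rep_eq)
  qed
  have "norm (endo_matrix E) \<le> (\<Sum>i\<in>UNIV. norm (endo_matrix E $ i))"
    unfolding norm_vec_def by (rule L2_set_le_sum) simp
  also have "\<dots> \<le> (\<Sum>i\<in>(UNIV::'n set). \<Sum>j\<in>(UNIV::'n set). \<bar>endo_matrix E $ i $ j\<bar>)"
    by (intro sum_mono norm_le_l1_cart)
  also have "\<dots> \<le> (\<Sum>i\<in>(UNIV::'n set). \<Sum>j\<in>(UNIV::'n set). norm E)"
    by (intro sum_mono entry)
  finally show "norm (endo_matrix E) \<le> norm E * (real CARD('n) * real CARD('n))"
    by (simp add: mult_ac)
qed

lemma mexp_eq: "mexp A = endo_matrix (exp (matrix_endo A))"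
proof -
  from bounded_linear.sums[OF bounded_linear_endo_matrix
      summable_sums[OF summable_exp_generic[of "matrix_endo A"]]]
  have "(\<lambda>k. endo_matrix ((matrix_endo A) ^ k /\<^sub>R fact k)) sums endo_matrix (exp (matrix_endo A))"
    by (simp add: exp_def)
  moreover have "endo_matrix ((matrix_endo A) ^ k /\<^sub>R fact k) = (1 / fact k) *\<^sub>R (((**) A ^^ k) (mat 1))" for k
    by (simp add: inverse_eq_divide flip: matrix_endo_power matrix_endo_scaleR)
  ultimately show ?thesis by (simp add: mexp_def sums_iff)
qed

lemma matrix_endo_mexp: "matrix_endo (mexp A) = exp (matrix_endo A)"
  by (simp add: mexp_eq)

lemma matrix_endo_eqI: "matrix_endo A = matrix_endo B \<Longrightarrow> A = B"
  by (drule arg_cong[where f=endo_matrix]) simp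

lemma mexp_0 [simp]: "mexp 0 = mat 1"
  by (rule matrix_endo_eqI)
    (simp add: matrix_endo_mexp matrix_endo_one linear_0[OF linear_matrix_endo])

lemma mexp_add_scaleR: "mexp ((s + t) *\<^sub>R X) = mexp (s *\<^sub>R X) ** mexp (t *\<^sub>R X)"
proof (rule matrix_endo_eqI)
  let ?x = "matrix_endo X"
  have "exp (s *\<^sub>R ?x + t *\<^sub>R ?x) = exp (s *\<^sub>R ?x) * exp (t *\<^sub>R ?x)"
    by (rule exp_add_commuting) simp
  then show "matrix_endo (mexp ((s + t) *\<^sub>R X)) = matrix_endo (mexp (s *\<^sub>R X) ** mexp (t *\<^sub>R X))"
    by (simp only: matrix_endo_mexp matrix_endo_mult matrix_endo_scaleR
        scaleR_add_left linear_add[OF linear_matrix_endo])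
qed

lemma mexp_minus_right: "mexp X ** mexp (- X) = mat 1"
  using mexp_add_scaleR[of 1 "-1" X] by simp

lemma mexp_minus_left: "mexp (- X) ** mexp X = mat 1"
  using mexp_add_scaleR[of "-1" 1 X] by simp

lemma matrix_inv_works:
  fixes A :: "real^'n^'n"
  assumes "invertible A"
  shows matrix_inv_right: "A ** matrix_inv A = mat 1" and matrix_inv_left: "matrix_inv A ** A = mat 1"
  using someI_ex[OF assms[unfolded invertible_def]] by (simp_all add: matrix_inv_def)

lemma matrix_inv_eqI:
  fixes A B :: "real^'n^'n"
  assumes "A ** B = mat 1" "B ** A = mat 1"
  shows "matrix_inv A = B"
proof -
  have "A ** matrix_inv A = mat 1"
    using assms unfolding invertible_def[symmetric] by (intro matrix_inv_right) (auto simp: invertible_def)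
  then have "B ** (A ** matrix_inv A) = B" by simp
  then show ?thesis using assms by (simp add: matrix_mul_assoc)
qed

lemma matrix_inv_mexp: "matrix_inv (mexp X) = mexp (- X)"
  by (rule matrix_inv_eqI[OF mexp_minus_right mexp_minus_left])

lemma invertible_mexp: "invertible (mexp X)"
  unfolding invertible_def using mexp_minus_left mexp_minus_right by blast

lemma mexp_scaleR_has_vector_derivative:
  "((\<lambda>t. mexp (t *\<^sub>R X)) has_vector_derivative X ** mexp (t *\<^sub>R X)) (at t)"
proof -
  have "((\<lambda>t. endo_matrix (exp (t *\<^sub>R matrix_endo X))) has_vector_derivative
      endo_matrix (matrix_endo X * exp (t *\<^sub>R matrix_endo X))) (at t)"
    by (intro bounded_linear.has_vector_derivative[OF bounded_linear_endo_matrix]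
        exp_scaleR_has_vector_derivative_left)
  moreover have "endo_matrix (matrix_endo X * exp (t *\<^sub>R matrix_endo X)) = X ** mexp (t *\<^sub>R X)"
    by (rule matrix_endo_eqI) (simp add: matrix_endo_mult matrix_endo_mexp matrix_endo_scaleR)
  ultimately show ?thesis by (simp add: mexp_eq matrix_endo_scaleR)
qed

lemma mexp_conjugate:
  fixes u v X :: "real^'n^'n"
  assumes "u ** v = mat 1" "v ** u = mat 1"
  shows "mexp (u ** X ** v) = u ** mexp X ** v"
proof -
  have "matrix_endo u * matrix_endo v = 1" "matrix_endo v * matrix_endo u = 1"
    using assms by (simp_all add: matrix_endo_one flip: matrix_endo_mult)
  then show ?thesis
    by (intro matrix_endo_eqI) (simp add: matrix_endo_mexp matrix_endo_mult exp_conjugate)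
qed

lemma mexp_lie_product:
  "(\<lambda>n. ((**) (mexp ((1 / real n) *\<^sub>R X) ** mexp ((1 / real n) *\<^sub>R Y)) ^^ n) (mat 1))
     \<longlonglongrightarrow> mexp (X + Y)"
proof -
  let ?P = "\<lambda>n. mexp ((1 / real n) *\<^sub>R X) ** mexp ((1 / real n) *\<^sub>R Y)"
  have "((**) (?P n) ^^ n) (mat 1) = endo_matrix
      ((exp ((1 / real n) *\<^sub>R matrix_endo X) * exp ((1 / real n) *\<^sub>R matrix_endo Y)) ^ n)" for n
    by (rule matrix_endo_eqI) (simp add: matrix_endo_power matrix_endo_mult matrix_endo_mexp matrix_endo_scaleR)
  moreover have "mexp (X + Y) = endo_matrix (exp (matrix_endo X + matrix_endo Y))"
    by (simp add: mexp_eq linear_add[OF linear_matrix_endo])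
  ultimately show ?thesis
    using bounded_linear.tendsto[OF bounded_linear_endo_matrix
        lie_product_formula[of "matrix_endo X" "matrix_endo Y"]]
    by simp
qed

section \<open>The Lie algebra of a real linear algebraic group\<close>

lemma bounded_bilinear_matrix_mult: "bounded_bilinear ((**) :: real^'n^'n \<Rightarrow> real^'n^'n \<Rightarrow> real^'n^'n)"
  unfolding bilinear_conv_bounded_bilinear[symmetric] bilinear_def
  by (intro conjI allI linearI)
    (simp_all add: vec_eq_iff matrix_matrix_mult_def sum.distrib sum_distrib_left algebra_simps)

lemma bounded_bilinear_matrix_vector_mult:
  "bounded_bilinear ((*v) :: real^'n^'n \<Rightarrow> real^'n \<Rightarrow> real^'n)"
  unfolding bilinear_conv_bounded_bilinear[symmetric] bilinear_def
  by (intro conjI allI linearI)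
    (simp_all add: matrix_vector_mult_add_rdistrib matrix_vector_right_distrib
      scaleR_matrix_vector_assoc matrix_vector_mult_scaleR)

lemma group_GL: "group GL"
proof (rule groupI)
  show "x \<otimes>\<^bsub>GL\<^esub> y \<in> carrier GL" if "x \<in> carrier GL" "y \<in> carrier GL" for x y :: "real^'n^'n"
    using that by (simp add: GL_def invertible_mult)
  show "\<exists>y\<in>carrier GL. y \<otimes>\<^bsub>GL\<^esub> x = \<one>\<^bsub>GL\<^esub>" if "x \<in> carrier GL" for x :: "real^'n^'n"
    using that by (auto simp: GL_def invertible_def)
qed (auto simp: GL_def matrix_mul_assoc invertible_def)

context
  fixes H :: "(real^'n^'n) set"
  assumes H: "subgroup H GL"
begin

lemma subgroup_GL_one: "mat 1 \<in> H"
  using subgroup.one_closed[OF H] by (simp add: GL_def)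

lemma subgroup_GL_mult: "A \<in> H \<Longrightarrow> B \<in> H \<Longrightarrow> A ** B \<in> H"
  using subgroup.m_closed[OF H] by (simp add: GL_def)

lemma subgroup_GL_invertible: "A \<in> H \<Longrightarrow> invertible A"
  using subgroup.subset[OF H] by (auto simp: GL_def)

lemma subgroup_GL_matrix_inv:
  assumes "A \<in> H"
  shows "matrix_inv A \<in> H"
proof -
  have "A ** matrix_inv A = mat 1" "matrix_inv A ** A = mat 1"
    using assms by (simp_all add: matrix_inv_right matrix_inv_left subgroup_GL_invertible)
  then have "inv\<^bsub>GL\<^esub> A = matrix_inv A"
    by (intro group.inv_equality[OF group_GL]) (auto simp: GL_def invertible_def)
  with subgroup.m_inv_closed[OF H assms] show ?thesis by simp
qed

lemma subgroup_GL_power: "A \<in> H \<Longrightarrow> ((**) A ^^ n) (mat 1) \<in> H"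
  by (induction n) (auto simp: subgroup_GL_one subgroup_GL_mult)

lemma lie_algebra_scaleR: "X \<in> lie_algebra H \<Longrightarrow> t *\<^sub>R X \<in> lie_algebra H"
  by (simp add: lie_algebra_def)

lemma lie_algebra_zero: "0 \<in> lie_algebra H"
  by (simp add: lie_algebra_def subgroup_GL_one)

lemma lie_algebra_conjugate:
  assumes "k \<in> H" "X \<in> lie_algebra H"
  shows "k ** X ** matrix_inv k \<in> lie_algebra H"
proof -
  have inv: "k ** matrix_inv k = mat 1" "matrix_inv k ** k = mat 1"
    using assms by (simp_all add: matrix_inv_right matrix_inv_left subgroup_GL_invertible)
  have "mexp (t *\<^sub>R (k ** X ** matrix_inv k)) \<in> H" for t
  proof -
    have "t *\<^sub>R (k ** X ** matrix_inv k) = k ** (t *\<^sub>R X) ** matrix_inv k"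
      by (simp add: bounded_bilinear.scaleR_left[OF bounded_bilinear_matrix_mult]
          bounded_bilinear.scaleR_right[OF bounded_bilinear_matrix_mult])
    then show ?thesis
      using assms inv
      by (simp add: mexp_conjugate subgroup_GL_mult subgroup_GL_matrix_inv lie_algebra_def)
  qed
  then show ?thesis by (simp add: lie_algebra_def)
qed

end

lemma closed_algebraic_set:
  fixes Z :: "'a::euclidean_space set"
  assumes "algebraic_set Z"
  shows "closed Z"
proof -
  obtain S where S: "\<And>p. p \<in> S \<Longrightarrow> real_polynomial_function p" "Z = {x. \<forall>p\<in>S. p x = 0}"
    using assms by (auto simp: algebraic_set_def)
  have "Z = (\<Inter>p\<in>S. {x. p x = 0})" using S by auto
  moreover have "closed {x. p x = 0}" if "p \<in> S" for p
  proof -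
    have "continuous_on UNIV p"
      by (rule continuous_on_polymonial_function) (use S that real_polynomial_function_eq in auto)
    then show ?thesis
      using continuous_closed_preimage_constant[of UNIV p 0] by simp
  qed
  ultimately show ?thesis by (auto intro: closed_INT)
qed

lemma real_linear_algebraic_group_limit:
  assumes G: "real_linear_algebraic_group G"
    and "\<And>n. A n \<in> G" "A \<longlonglongrightarrow> B" "invertible B"
  shows "B \<in> G"
proof -
  obtain Z where Z: "algebraic_set Z" "G = Z \<inter> carrier GL"
    using G by (auto simp: real_linear_algebraic_group_def)
  then have "B \<in> Z"
    using closed_sequentially[OF closed_algebraic_set] assms by blast
  with Z \<open>invertible B\<close> show ?thesis by (simp add: GL_def)
qed

lemma lie_algebra_add:
  assumes G: "real_linear_algebraic_group G"
    and X: "X \<in> lie_algebra G" and Y: "Y \<in> lie_algebra G"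
  shows "X + Y \<in> lie_algebra G"
proof -
  have sub: "subgroup G GL" using G by (simp add: real_linear_algebraic_group_def)
  have "mexp (t *\<^sub>R (X + Y)) \<in> G" for t
  proof (rule real_linear_algebraic_group_limit[OF G])
    show "(\<lambda>n. ((**) (mexp ((1 / real n) *\<^sub>R (t *\<^sub>R X)) ** mexp ((1 / real n) *\<^sub>R (t *\<^sub>R Y))) ^^ n) (mat 1))
        \<longlonglongrightarrow> mexp (t *\<^sub>R (X + Y))"
      unfolding scaleR_add_right by (rule mexp_lie_product)
    show "((**) (mexp ((1 / real n) *\<^sub>R (t *\<^sub>R X)) ** mexp ((1 / real n) *\<^sub>R (t *\<^sub>R Y))) ^^ n) (mat 1) \<in> G" for n
      using X Y by (intro subgroup_GL_power[OF sub] subgroup_GL_mult[OF sub]) (simp_all add: lie_algebra_def)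
  qed (rule invertible_mexp)
  then show ?thesis by (simp add: lie_algebra_def)
qed

lemma subspace_lie_algebra:
  assumes "real_linear_algebraic_group G"
  shows "subspace (lie_algebra G)"
  using assms unfolding subspace_def
  by (auto simp: lie_algebra_zero lie_algebra_scaleR lie_algebra_add real_linear_algebraic_group_def)

lemma has_vector_derivative_imp_quotient_tendsto:
  "(f has_vector_derivative f') (at 0) \<Longrightarrow> ((\<lambda>t. (1 / t) *\<^sub>R (f t - f 0)) \<longlongrightarrow> f') (at 0)"
proof -
  assume "(f has_vector_derivative f') (at 0)"
  then have lim: "((\<lambda>t. norm (f t - f 0 - t *\<^sub>R f') / norm t) \<longlongrightarrow> 0) (at 0)"
    by (simp add: has_vector_derivative_def has_derivative_at)
  have "((\<lambda>t. norm ((1 / t) *\<^sub>R (f t - f 0) - f')) \<longlongrightarrow> 0) (at 0)"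
  proof (rule Lim_transform_eventually[OF lim])
    have "norm (f t - f 0 - t *\<^sub>R f') / norm t = norm ((1 / t) *\<^sub>R (f t - f 0) - f')" if "t \<noteq> 0" for t
    proof -
      have "(1 / t) *\<^sub>R (f t - f 0) - f' = (1 / t) *\<^sub>R (f t - f 0 - t *\<^sub>R f')"
        using that by (simp add: scaleR_diff_right)
      then show ?thesis by (simp add: divide_inverse_commute)
    qed
    then show "\<forall>\<^sub>F t in at 0. norm (f t - f 0 - t *\<^sub>R f') / norm t = norm ((1 / t) *\<^sub>R (f t - f 0) - f')"
      by (auto simp: eventually_at_filter)
  qed
  then show ?thesis
    by (simp add: tendsto_norm_zero_iff LIM_zero_iff)
qed

lemma lie_algebra_bracket:
  fixes G :: "(real^'n^'n) set"
  assumes G: "real_linear_algebraic_group G"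
    and X: "X \<in> lie_algebra G" and Y: "Y \<in> lie_algebra G"
  shows "lie_bracket X Y \<in> lie_algebra G"
proof -
  note bb = bounded_bilinear_matrix_mult
  have sub: "subgroup G GL" using G by (simp add: real_linear_algebraic_group_def)
  define c where "c s = mexp (s *\<^sub>R X) ** Y ** mexp (s *\<^sub>R (- X))" for s
  have c_mem: "c s \<in> lie_algebra G" for s
  proof -
    have "mexp (s *\<^sub>R X) \<in> G" using X by (simp add: lie_algebra_def)
    from lie_algebra_conjugate[OF sub this Y] show ?thesis
      by (simp add: c_def matrix_inv_mexp)
  qed
  have "((\<lambda>s. mexp (s *\<^sub>R X) ** Y) has_vector_derivative
      mexp (0 *\<^sub>R X) ** 0 + (X ** mexp (0 *\<^sub>R X)) ** Y) (at 0)"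
    by (intro bounded_bilinear.has_vector_derivative[OF bb] mexp_scaleR_has_vector_derivative
        has_vector_derivative_const)
  from bounded_bilinear.has_vector_derivative[OF bb this mexp_scaleR_has_vector_derivative[of "- X"]]
  have "(c has_vector_derivative lie_bracket X Y) (at 0)"
    unfolding c_def
    by (simp add: lie_bracket_def bounded_bilinear.zero_right[OF bb] bounded_bilinear.minus_right[OF bb]
        bounded_bilinear.minus_left[OF bb])
  then have lim: "((\<lambda>s. (1 / s) *\<^sub>R (c s - c 0)) \<longlongrightarrow> lie_bracket X Y) (at 0)"
    by (rule has_vector_derivative_imp_quotient_tendsto)
  show ?thesis
  proof (rule Lim_in_closed_set[OF closed_subspace[OF subspace_lie_algebra[OF G]] _ _ lim])
    show "\<forall>\<^sub>F s in at 0. (1 / s) *\<^sub>R (c s - c 0) \<in> lie_algebra G"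
      by (intro always_eventually allI subspace_scale[OF subspace_lie_algebra[OF G]]
          subspace_diff[OF subspace_lie_algebra[OF G]] c_mem)
  qed simp
qed

section \<open>Complex polynomials times the Gaussian\<close>

lemma polynomial_function_complex_iff:
  fixes p :: "'a::real_normed_vector \<Rightarrow> complex"
  shows "polynomial_function p \<longleftrightarrow>
    real_polynomial_function (\<lambda>x. Re (p x)) \<and> real_polynomial_function (\<lambda>x. Im (p x))"
  by (simp add: polynomial_function_iff_Basis_inner Basis_complex_def inner_complex_def)

lemma polynomial_function_times [intro]:
  fixes f g :: "'a::real_normed_vector \<Rightarrow> complex"
  assumes "polynomial_function f" "polynomial_function g"
  shows "polynomial_function (\<lambda>x. f x * g x)"
  using assms by (auto simp: polynomial_function_complex_iff)

lemma polynomial_function_of_real: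
  "real_polynomial_function f \<Longrightarrow> polynomial_function (\<lambda>x. complex_of_real (f x))"
  by (auto simp: polynomial_function_complex_iff)

lemma complex_polynomial_induct [consumes 1, case_names const linear add mult]:
  fixes p :: "'a::real_normed_vector \<Rightarrow> complex"
  assumes p: "polynomial_function p"
    and const: "\<And>c. P (\<lambda>x. c)"
    and linear: "\<And>f :: 'a \<Rightarrow> real. bounded_linear f \<Longrightarrow> P (\<lambda>x. complex_of_real (f x))"
    and add: "\<And>f g. polynomial_function f \<Longrightarrow> polynomial_function g \<Longrightarrow> P f \<Longrightarrow> P g \<Longrightarrow> P (\<lambda>x. f x + g x)"
    and mult: "\<And>f g. polynomial_function f \<Longrightarrow> polynomial_function g \<Longrightarrow> P f \<Longrightarrow> P g \<Longrightarrow> P (\<lambda>x. f x * g x)"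
  shows "P p"
proof -
  note poly = polynomial_function_of_real
  have real: "P (\<lambda>x. complex_of_real (f x))" if "real_polynomial_function f" for f :: "'a \<Rightarrow> real"
    using that
  proof induction
    case (add f g)
    then have "P (\<lambda>x. complex_of_real (f x) + complex_of_real (g x))"
      by (intro assms(4) poly)
    then show ?case by simp
  next
    case (mult f g)
    then have "P (\<lambda>x. complex_of_real (f x) * complex_of_real (g x))"
      by (intro assms(5) poly)
    then show ?case by simp
  qed (simp_all add: const linear)
  have re: "real_polynomial_function (\<lambda>x. Re (p x))" and im: "real_polynomial_function (\<lambda>x. Im (p x))"
    using p by (simp_all add: polynomial_function_complex_iff)
  have "P (\<lambda>x. complex_of_real (Re (p x)) + \<i> * complex_of_real (Im (p x)))"
    using re im by (intro add mult real const poly polynomial_function_times polynomial_function_const)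
  then show ?thesis by (simp flip: complex_eq)
qed

lemma polynomial_function_differentiable:
  fixes p :: "'a::euclidean_space \<Rightarrow> complex"
  assumes "polynomial_function p"
  shows "p differentiable (at x)"
  using assms by (rule differentiable_at_polynomial_function)

definition vf_deriv :: "real^'n^'n \<Rightarrow> (real^'n \<Rightarrow> complex) \<Rightarrow> real^'n \<Rightarrow> complex" where
  "vf_deriv X p = (\<lambda>m. frechet_derivative p (at m) (X *v m))"

lemma vf_deriv_eqI: "(p has_derivative p') (at m) \<Longrightarrow> vf_deriv X p m = p' (X *v m)"
  by (simp add: vf_deriv_def frechet_derivative_at[symmetric])

lemma vf_deriv_const [simp]: "vf_deriv X (\<lambda>m. c) = (\<lambda>m. 0)"
  by (simp add: vf_deriv_def)

lemma vf_deriv_linear: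
  "bounded_linear f \<Longrightarrow> vf_deriv X (\<lambda>m. complex_of_real (f m)) = (\<lambda>m. complex_of_real (f (X *v m)))"
  by (intro ext vf_deriv_eqI bounded_linear_imp_has_derivative
      bounded_linear_compose[OF bounded_linear_of_real])

lemma vf_deriv_add:
  assumes "polynomial_function f" "polynomial_function g"
  shows "vf_deriv X (\<lambda>m. f m + g m) = (\<lambda>m. vf_deriv X f m + vf_deriv X g m)"
proof
  fix m
  have "((\<lambda>m. f m + g m) has_derivative
      (\<lambda>v. frechet_derivative f (at m) v + frechet_derivative g (at m) v)) (at m)"
    by (intro has_derivative_add frechet_derivative_works[THEN iffD1] polynomial_function_differentiable assms)
  then show "vf_deriv X (\<lambda>m. f m + g m) m = vf_deriv X f m + vf_deriv X g m"
    by (simp add: vf_deriv_eqI) (simp add: vf_deriv_def)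
qed

lemma vf_deriv_mult:
  assumes "polynomial_function f" "polynomial_function g"
  shows "vf_deriv X (\<lambda>m. f m * g m) = (\<lambda>m. f m * vf_deriv X g m + vf_deriv X f m * g m)"
proof
  fix m
  have "((\<lambda>m. f m * g m) has_derivative
      (\<lambda>v. f m * frechet_derivative g (at m) v + frechet_derivative f (at m) v * g m)) (at m)"
    by (intro has_derivative_mult frechet_derivative_works[THEN iffD1] polynomial_function_differentiable assms)
  then show "vf_deriv X (\<lambda>m. f m * g m) m = f m * vf_deriv X g m + vf_deriv X f m * g m"
    by (simp add: vf_deriv_eqI) (simp add: vf_deriv_def)
qed

lemma vf_deriv_minus:
  assumes "polynomial_function f"
  shows "vf_deriv X (\<lambda>m. - f m) = (\<lambda>m. - vf_deriv X f m)"
  using vf_deriv_mult[of "\<lambda>_. - 1" f X] assms by simp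

lemma polynomial_function_of_real_linear:
  assumes "bounded_linear f"
  shows "polynomial_function (\<lambda>x. complex_of_real (f x))"
  by (intro polynomial_function_bounded_linear bounded_linear_compose[OF bounded_linear_of_real] assms)

lemma bounded_linear_compose_matrix: "bounded_linear f \<Longrightarrow> bounded_linear (\<lambda>m. f (X *v m))"
  for X :: "real^'n^'n"
  by (rule bounded_linear_compose[OF _ matrix_vector_mul_bounded_linear])

lemma polynomial_function_vf_deriv:
  "polynomial_function p \<Longrightarrow> polynomial_function (vf_deriv X p)"
proof (induction p rule: complex_polynomial_induct)
  case (linear f)
  then show ?case
    by (simp add: vf_deriv_linear polynomial_function_of_real_linear bounded_linear_compose_matrix)
qed (auto simp: vf_deriv_add vf_deriv_mult)

lemma vf_deriv_linear_field:
  assumes "polynomial_function p"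
  shows "vf_deriv (X + Y) p m = vf_deriv X p m + vf_deriv Y p m"
    and "vf_deriv (t *\<^sub>R X) p m = complex_of_real t * vf_deriv X p m"
proof -
  have "bounded_linear (frechet_derivative p (at m))"
    using polynomial_function_differentiable[OF assms] frechet_derivative_works has_derivative_bounded_linear
    by blast
  then have "linear (frechet_derivative p (at m))" by (rule bounded_linear.linear)
  then show "vf_deriv (X + Y) p m = vf_deriv X p m + vf_deriv Y p m"
    and "vf_deriv (t *\<^sub>R X) p m = complex_of_real t * vf_deriv X p m"
    by (simp_all add: vf_deriv_def matrix_vector_mult_add_rdistrib linear_add linear_scale
        scaleR_conv_of_real[of _ "_ :: complex"] flip: scaleR_matrix_vector_assoc)
qed

lemma vf_deriv_bracket:
  "polynomial_function p \<Longrightarrow>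
    vf_deriv X (vf_deriv Y p) m - vf_deriv Y (vf_deriv X p) m = - vf_deriv (lie_bracket X Y) p m"
proof (induction p arbitrary: m rule: complex_polynomial_induct)
  case (linear f)
  then show ?case
    by (simp add: vf_deriv_linear bounded_linear_compose_matrix lie_bracket_def
        matrix_vector_mult_diff_rdistrib linear_diff bounded_linear.linear
        flip: matrix_vector_mul_assoc)
next
  case (add f g)
  then show ?case
    by (simp add: vf_deriv_add polynomial_function_vf_deriv algebra_simps)
next
  case (mult f g)
  have "f m * (vf_deriv X (vf_deriv Y g) m - vf_deriv Y (vf_deriv X g) m)
      = f m * (- vf_deriv (lie_bracket X Y) g m)"
    "(vf_deriv X (vf_deriv Y f) m - vf_deriv Y (vf_deriv X f) m) * g m
      = (- vf_deriv (lie_bracket X Y) f m) * g m"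
    by (simp_all add: mult.IH)
  then show ?case
    by (simp add: vf_deriv_add vf_deriv_mult mult.hyps polynomial_function_vf_deriv
        polynomial_function_times algebra_simps)
qed simp

text \<open>The operator on polynomials that corresponds to \<open>d\<pi>(X)\<close> once the Gaussian is factored out:
  \<open>- X (p e\<^sup>-\<^sup>r\<^sup>2) = (gauss_deriv X p) e\<^sup>-\<^sup>r\<^sup>2\<close> for the vector field \<open>m \<mapsto> X m\<close>.\<close>

definition gauss_deriv :: "real^'n^'n \<Rightarrow> (real^'n \<Rightarrow> complex) \<Rightarrow> real^'n \<Rightarrow> complex" where
  "gauss_deriv X p = (\<lambda>m. - vf_deriv X p m + p m * complex_of_real (2 * (m \<bullet> (X *v m))))"

lemma polynomial_function_quadratic: "polynomial_function (\<lambda>m. complex_of_real (2 * (m \<bullet> (X *v m))))"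
  for X :: "real^'n^'n"
proof (intro polynomial_function_of_real real_polynomial_function.intros(2,4))
  show "real_polynomial_function (\<lambda>m. m \<bullet> (X *v m))"
    unfolding inner_vec_def inner_real_def
    by (intro real_polynomial_function_sum real_polynomial_function.intros(1,4) finite
        bounded_linear_vec_nth bounded_linear_compose[OF bounded_linear_vec_nth matrix_vector_mul_bounded_linear])
qed

lemma polynomial_function_gauss_deriv:
  "polynomial_function p \<Longrightarrow> polynomial_function (gauss_deriv X p)"
  unfolding gauss_deriv_def
  by (intro polynomial_function_add polynomial_function_minus polynomial_function_times
      polynomial_function_quadratic polynomial_function_vf_deriv)

lemma vf_deriv_quadratic:
  "vf_deriv X (\<lambda>m. complex_of_real (2 * (m \<bullet> (Y *v m))))
    = (\<lambda>m. complex_of_real (2 * (m \<bullet> (Y *v (X *v m)) + (X *v m) \<bullet> (Y *v m))))"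
proof
  fix m
  have "((\<lambda>m. complex_of_real (2 * (m \<bullet> (Y *v m)))) has_derivative
      (\<lambda>v. complex_of_real (2 * (m \<bullet> (Y *v v) + v \<bullet> (Y *v m))))) (at m)"
    by (intro bounded_linear.has_derivative[OF bounded_linear_of_real]
        bounded_linear.has_derivative[OF bounded_linear_mult_right]
        has_derivative_inner has_derivative_ident
        bounded_linear_imp_has_derivative matrix_vector_mul_bounded_linear)
  then show "vf_deriv X (\<lambda>m. complex_of_real (2 * (m \<bullet> (Y *v m)))) m
    = complex_of_real (2 * (m \<bullet> (Y *v (X *v m)) + (X *v m) \<bullet> (Y *v m)))"
    by (rule vf_deriv_eqI)
qed

lemma gauss_deriv_field:
  assumes "polynomial_function p"
  shows "gauss_deriv (X + Y) p = (\<lambda>m. gauss_deriv X p m + gauss_deriv Y p m)"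
    and "gauss_deriv (t *\<^sub>R X) p = (\<lambda>m. complex_of_real t * gauss_deriv X p m)"
  using assms
  by (simp_all add: fun_eq_iff gauss_deriv_def vf_deriv_linear_field matrix_vector_mult_add_rdistrib inner_add_right
      algebra_simps flip: scaleR_matrix_vector_assoc)

lemma gauss_deriv_add:
  assumes "polynomial_function p" "polynomial_function q"
  shows "gauss_deriv X (\<lambda>m. p m + q m) = (\<lambda>m. gauss_deriv X p m + gauss_deriv X q m)"
  using assms by (simp add: gauss_deriv_def vf_deriv_add algebra_simps)

lemma gauss_deriv_cmult:
  assumes "polynomial_function p"
  shows "gauss_deriv X (\<lambda>m. c * p m) = (\<lambda>m. c * gauss_deriv X p m)"
  using assms by (simp add: gauss_deriv_def vf_deriv_mult algebra_simps)

lemma gauss_deriv_bracket: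
  fixes X Y :: "real^'n^'n"
  assumes p: "polynomial_function p"
  shows "gauss_deriv (lie_bracket X Y) p m
    = gauss_deriv X (gauss_deriv Y p) m - gauss_deriv Y (gauss_deriv X p) m"
proof -
  define q where "q X = (\<lambda>m. complex_of_real (2 * (m \<bullet> (X *v m))))" for X :: "real^'n^'n"
  have q: "polynomial_function (q X)" for X
    unfolding q_def by (rule polynomial_function_quadratic)
  have gd: "gauss_deriv X f m = - vf_deriv X f m + f m * q X m" for X :: "real^'n^'n" and f m
    by (simp add: gauss_deriv_def q_def)
  have qb: "vf_deriv Y (q X) m - vf_deriv X (q Y) m = q (lie_bracket X Y) m"
    unfolding q_def vf_deriv_quadratic
    by (simp add: lie_bracket_def matrix_vector_mult_diff_rdistrib inner_diff_right inner_commute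
        algebra_simps flip: matrix_vector_mul_assoc)
  have step: "gauss_deriv X (gauss_deriv Y p) m =
      vf_deriv X (vf_deriv Y p) m - p m * vf_deriv X (q Y) m - vf_deriv X p m * q Y m
      - vf_deriv Y p m * q X m + p m * q Y m * q X m" for X Y :: "real^'n^'n"
  proof -
    have "gauss_deriv Y p = (\<lambda>m. - vf_deriv Y p m + p m * q Y m)"
      by (rule ext) (rule gd)
    moreover have "vf_deriv X (\<lambda>m. - vf_deriv Y p m + p m * q Y m) m =
        - vf_deriv X (vf_deriv Y p) m + p m * vf_deriv X (q Y) m + vf_deriv X p m * q Y m"
      using p q
      by (subst vf_deriv_add)
        (simp_all add: vf_deriv_minus vf_deriv_mult polynomial_function_vf_deriv
          polynomial_function_times polynomial_function_minus)
    ultimately have "vf_deriv X (gauss_deriv Y p) m =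
        - vf_deriv X (vf_deriv Y p) m + p m * vf_deriv X (q Y) m + vf_deriv X p m * q Y m"
      by (simp only:)
    then show ?thesis
      unfolding gd[of X] gd[of Y p m] by (simp add: algebra_simps)
  qed
  have "gauss_deriv X (gauss_deriv Y p) m - gauss_deriv Y (gauss_deriv X p) m
    = (vf_deriv X (vf_deriv Y p) m - vf_deriv Y (vf_deriv X p) m)
      + p m * (vf_deriv Y (q X) m - vf_deriv X (q Y) m)"
    unfolding step by (simp add: algebra_simps)
  also have "\<dots> = gauss_deriv (lie_bracket X Y) p m"
    unfolding vf_deriv_bracket[OF p] qb by (simp add: gauss_deriv_def q_def)
  finally show ?thesis by simp
qed

lemma r2_eq: "r2 m = m \<bullet> m"
  by (simp add: r2_def inner_vec_def power2_eq_square)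

lemma polynomial_function_exp_bound:
  fixes p :: "'a::real_normed_vector \<Rightarrow> complex"
  assumes "polynomial_function p"
  shows "a > 0 \<Longrightarrow> \<exists>C\<ge>0. \<forall>x. cmod (p x) \<le> C * exp (a * norm x)"
  using assms
proof (induction p arbitrary: a rule: complex_polynomial_induct)
  case (const c)
  have "cmod c \<le> cmod c * exp (a * norm x)" for x :: 'a
    using const by (simp add: mult_le_cancel_left1)
  then show ?case by (intro exI[of _ "cmod c"]) auto
next
  case (linear f)
  then obtain K where K: "K > 0" "\<And>x. norm (f x) \<le> norm x * K"
    using bounded_linear.pos_bounded by blast
  have "cmod (complex_of_real (f x)) \<le> K / a * exp (a * norm x)" for x
  proof -
    have "a * norm x \<le> exp (a * norm x)"
      using exp_ge_add_one_self[of "a * norm x"] by linarith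
    then have "K / a * (a * norm x) \<le> K / a * exp (a * norm x)"
      using K linear by (intro mult_left_mono) auto
    then show ?thesis using K(2)[of x] linear by (simp add: mult.commute)
  qed
  then show ?case using K linear by (intro exI[of _ "K / a"]) auto
next
  case (add f g)
  then obtain C D where "C \<ge> 0" "D \<ge> 0" "\<forall>x. cmod (f x) \<le> C * exp (a * norm x)"
    "\<forall>x. cmod (g x) \<le> D * exp (a * norm x)"
    by metis
  then show ?case
    by (intro exI[of _ "C + D"]) (auto simp: distrib_right intro!: norm_triangle_le add_mono)
next
  case (mult f g)
  then have "a / 2 > 0" by simp
  with mult obtain C D where CD: "C \<ge> 0" "D \<ge> 0" "\<forall>x. cmod (f x) \<le> C * exp (a / 2 * norm x)"
    "\<forall>x. cmod (g x) \<le> D * exp (a / 2 * norm x)"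
    by metis
  have "cmod (f x * g x) \<le> C * D * exp (a * norm x)" for x
  proof -
    have "cmod (f x * g x) \<le> (C * exp (a / 2 * norm x)) * (D * exp (a / 2 * norm x))"
      unfolding norm_mult using CD by (intro mult_mono) auto
    also have "\<dots> = C * D * exp (a * norm x)"
      by (simp add: mult_ac flip: exp_add)
    finally show ?thesis .
  qed
  then show ?case using CD by (intro exI[of _ "C * D"]) auto
qed

definition gauss :: "(real^'n \<Rightarrow> complex) \<Rightarrow> real^'n \<Rightarrow> complex" where
  "gauss p = (\<lambda>m. p m * complex_of_real (exp (- r2 m)))"

lemma gauss_decay:
  assumes "polynomial_function p"
  shows "\<exists>C\<ge>0. \<forall>x. cmod (gauss p x) \<le> C * exp (- norm x)"
proof -
  obtain C where C: "C \<ge> 0" "\<And>x. cmod (p x) \<le> C * exp (norm x)"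
    using polynomial_function_exp_bound[OF assms, of 1] by auto
  have "cmod (gauss p x) \<le> C * exp 1 * exp (- norm x)" for x
  proof -
    have "cmod (gauss p x) = cmod (p x) * exp (- r2 x)"
      by (simp add: gauss_def norm_mult)
    also have "\<dots> \<le> C * exp (norm x) * exp (- r2 x)"
      using C by (intro mult_right_mono) auto
    also have "\<dots> = C * exp (norm x - r2 x)"
      by (simp add: exp_diff exp_minus divide_inverse)
    also have "\<dots> \<le> C * exp (1 - norm x)"
    proof -
      have "0 \<le> (norm x - 1)\<^sup>2" by simp
      then have "norm x - r2 x \<le> 1 - norm x"
        by (simp add: r2_eq power2_eq_square algebra_simps flip: power2_norm_eq_inner)
      then show ?thesis using C by (intro mult_left_mono) auto
    qed
    finally show ?thesis by (simp add: exp_diff exp_minus divide_inverse)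
  qed
  then show ?thesis using C by (intro exI[of _ "C * exp 1"]) auto
qed

lemma gauss_has_derivative:
  assumes "polynomial_function p"
  shows "(gauss p has_derivative
     (\<lambda>v. (frechet_derivative p (at m) v - p m * complex_of_real (2 * (m \<bullet> v))) * complex_of_real (exp (- r2 m)))) (at m)"
proof -
  have "(p has_derivative frechet_derivative p (at m)) (at m)"
    using polynomial_function_differentiable[OF assms] frechet_derivative_works by blast
  moreover have "((\<lambda>m. exp (- r2 m)) has_derivative (\<lambda>v. exp (- r2 m) * - (2 * (m \<bullet> v)))) (at m)"
    unfolding r2_eq by (auto intro!: derivative_eq_intros simp: inner_commute)
  ultimately have "(gauss p has_derivative
      (\<lambda>v. p m * complex_of_real (exp (- r2 m) * - (2 * (m \<bullet> v)))
        + frechet_derivative p (at m) v * complex_of_real (exp (- r2 m)))) (at m)"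
    unfolding gauss_def
    by (intro has_derivative_mult bounded_linear.has_derivative[OF bounded_linear_of_real])
  then show ?thesis by (simp add: algebra_simps)
qed

lemma gauss_flow_has_vector_derivative:
  assumes p: "polynomial_function p"
  shows "((\<lambda>t. gauss p (mexp (t *\<^sub>R - X) *v m)) has_vector_derivative
     gauss (gauss_deriv X p) (mexp (t *\<^sub>R - X) *v m)) (at t)"
proof -
  let ?x = "\<lambda>t. mexp (t *\<^sub>R - X) *v m"
  have "(?x has_vector_derivative
      mexp (t *\<^sub>R - X) *v 0 + (- X ** mexp (t *\<^sub>R - X)) *v m) (at t)"
    by (intro bounded_bilinear.has_vector_derivative[OF bounded_bilinear_matrix_vector_mult]
        mexp_scaleR_has_vector_derivative has_vector_derivative_const)
  then have "(?x has_vector_derivative - (X *v ?x t)) (at t)"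
    by (simp add: bounded_bilinear.minus_left[OF bounded_bilinear_matrix_mult]
        bounded_bilinear.minus_left[OF bounded_bilinear_matrix_vector_mult] matrix_vector_mul_assoc)
  from vector_derivative_diff_chain_within[OF this has_derivative_at_withinI[OF gauss_has_derivative[OF p]]]
  have "((gauss p \<circ> ?x) has_vector_derivative
      (frechet_derivative p (at (?x t)) (- (X *v ?x t)) - p (?x t) * complex_of_real (2 * (?x t \<bullet> - (X *v ?x t))))
      * complex_of_real (exp (- r2 (?x t)))) (at t)" .
  moreover have "frechet_derivative p (at (?x t)) (- (X *v ?x t)) = - vf_deriv X p (?x t)"
    using polynomial_function_differentiable[OF p] frechet_derivative_works has_derivative_linear
      linear_neg unfolding vf_deriv_def by blast
  ultimately show ?thesis
    by (simp add: o_def gauss_def[of "gauss_deriv X p"]) (simp add: gauss_def gauss_deriv_def)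
qed

lemma second_order_bound:
  fixes u :: "real \<Rightarrow> complex"
  assumes u: "\<And>t. (u has_vector_derivative u' t) (at t)" "\<And>t. (u' has_vector_derivative u'' t) (at t)"
    and C: "\<And>t. cmod (u'' t) \<le> C"
  shows "cmod (u h - u 0 - h *\<^sub>R u' 0) \<le> 3 * C * h\<^sup>2"
proof -
  have u': "cmod (u' x - u' 0) \<le> 3 * C * \<bar>x\<bar>" for x
  proof -
    have "cmod (u' x - u' 0 - (x - 0) *\<^sub>R u'' 0) \<le> norm (x - 0) * (2 * C)"
    proof (rule vector_differentiable_bound_linearization[where S=UNIV])
      show "cmod (u'' y - u'' 0) \<le> 2 * C" for y
        using C[of y] C[of 0] norm_triangle_ineq4[of "u'' y" "u'' 0"] by linarith
    qed (auto simp: u)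
    moreover have "cmod (x *\<^sub>R u'' 0) \<le> \<bar>x\<bar> * C"
      using C[of 0] by (simp add: mult_left_mono)
    ultimately show ?thesis
      using norm_triangle_ineq[of "u' x - u' 0 - x *\<^sub>R u'' 0" "x *\<^sub>R u'' 0"] by (simp add: algebra_simps)
  qed
  have "C \<ge> 0" using C[of 0] norm_ge_zero order_trans by blast
  have "cmod (u h - u 0 - (h - 0) *\<^sub>R u' 0) \<le> norm (h - 0) * (3 * C * \<bar>h\<bar>)"
  proof (rule vector_differentiable_bound_linearization[where S="{- \<bar>h\<bar>..\<bar>h\<bar>}"])
    show "cmod (u' y - u' 0) \<le> 3 * C * \<bar>h\<bar>" if "y \<in> {- \<bar>h\<bar>..\<bar>h\<bar>}" for y
    proof -
      have "3 * C * \<bar>y\<bar> \<le> 3 * C * \<bar>h\<bar>"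
        using that \<open>C \<ge> 0\<close> by (intro mult_left_mono) auto
      then show ?thesis using u'[of y] by linarith
    qed
  qed (auto simp: has_vector_derivative_at_within u closed_segment_eq_real_ivl)
  then show ?thesis by (simp add: power2_eq_square mult_ac abs_mult_self_eq)
qed

section \<open>The derived action\<close>

lemma C0_bounded:
  assumes "f \<in> C0 M"
  shows "\<exists>B. \<forall>x. cmod (f x) \<le> B"
proof -
  let ?K = "{m\<in>M. 1 \<le> cmod (f m)}"
  have "compact ?K" "continuous_on ?K f"
    using assms by (auto simp: C0_def intro: continuous_on_subset)
  then have "bounded (f ` ?K)"
    by (intro compact_imp_bounded compact_continuous_image)
  then obtain B where B: "\<And>x. x \<in> ?K \<Longrightarrow> cmod (f x) \<le> B"
    by (auto simp: bounded_iff)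
  have "cmod (f x) \<le> max 1 B" for x
  proof (cases "x \<in> ?K")
    case True
    then show ?thesis using B[OF True] by linarith
  next
    case False
    then show ?thesis using assms by (cases "x \<in> M") (auto simp: C0_def)
  qed
  then show ?thesis by (intro exI allI)
qed

lemma sup_norm_bounds:
  assumes B: "\<And>m. m \<in> M \<Longrightarrow> cmod (f m) \<le> B"
  shows "0 \<le> sup_norm M f" and "m \<in> M \<Longrightarrow> cmod (f m) \<le> sup_norm M f"
    and "0 \<le> B \<Longrightarrow> sup_norm M f \<le> B"
proof -
  have bdd: "bdd_above (insert 0 ((\<lambda>m. cmod (f m)) ` M))"
    using B by (auto intro!: bdd_aboveI[of _ B])
  show "0 \<le> sup_norm M f" "m \<in> M \<Longrightarrow> cmod (f m) \<le> sup_norm M f"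
    unfolding sup_norm_def by (auto intro!: cSup_upper bdd)
  show "0 \<le> B \<Longrightarrow> sup_norm M f \<le> B"
    unfolding sup_norm_def using B by (intro cSup_least) auto
qed

lemma has_dpi_C0: "has_dpi M X f f' \<Longrightarrow> f' \<in> C0 M"
  unfolding has_dpi_def by (rule conjunct1)

lemma has_dpi_tendsto:
  "has_dpi M X f f' \<Longrightarrow> ((\<lambda>h::real. sup_norm M
     (fscale (1 / complex_of_real h) (translate (mexp (h *\<^sub>R X)) f - f) - f')) \<longlongrightarrow> 0) (at 0)"
  unfolding has_dpi_def by (rule conjunct2)

lemma has_dpi_unique:
  assumes f: "\<And>x. cmod (f x) \<le> B" and "has_dpi M X f f'" "has_dpi M X f f''"
  shows "f' = f''"
proof
  fix m
  define A where "A = (\<lambda>h::real. fscale (1 / complex_of_real h) (translate (mexp (h *\<^sub>R X)) f - f))"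
  have f': "f' \<in> C0 M" "f'' \<in> C0 M"
    by (rule has_dpi_C0[OF assms(2)], rule has_dpi_C0[OF assms(3)])
  show "f' m = f'' m"
  proof (cases "m \<in> M")
    case False
    then show ?thesis using f' by (simp add: C0_def)
  next
    case True
    have le: "cmod ((A h - g) m) \<le> sup_norm M (A h - g)" if "g \<in> C0 M" for g h
    proof -
      obtain C where C: "\<And>x. cmod (g x) \<le> C" using C0_bounded[OF \<open>g \<in> C0 M\<close>] by blast
      have "cmod ((A h - g) x) \<le> cmod (1 / complex_of_real h) * (B + B) + C" for x
      proof -
        have "cmod (translate (mexp (h *\<^sub>R X)) f x - f x) \<le> B + B"
          unfolding translate_def by (rule norm_triangle_le_diff, rule add_mono[OF f f])
        then have "cmod (A h x) \<le> cmod (1 / complex_of_real h) * (B + B)"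
          unfolding A_def fscale_def minus_apply norm_mult by (rule mult_left_mono) simp
        then show ?thesis
          unfolding minus_apply[of "A h"] by (intro norm_triangle_le_diff add_mono C)
      qed
      from sup_norm_bounds(2)[OF this True] show ?thesis .
    qed
    have bound: "cmod (f' m - f'' m) \<le> sup_norm M (A h - f') + sup_norm M (A h - f'')" for h
    proof -
      have "cmod (A h m - f' m) \<le> sup_norm M (A h - f')" "cmod (A h m - f'' m) \<le> sup_norm M (A h - f'')"
        using le[OF f'(1), of h] le[OF f'(2), of h] by (simp_all only: minus_apply)
      then show ?thesis
        using norm_triangle_ineq4[of "A h m - f'' m" "A h m - f' m"] by simp
    qed
    have "((\<lambda>h. sup_norm M (A h - f') + sup_norm M (A h - f'')) \<longlongrightarrow> 0 + 0) (at 0)"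
      unfolding A_def
      by (rule tendsto_add[OF has_dpi_tendsto[OF assms(2)] has_dpi_tendsto[OF assms(3)]])
    then have "cmod (f' m - f'' m) \<le> 0 + 0"
      by (rule tendsto_lowerbound) (intro always_eventually allI bound, simp)
    then show ?thesis by simp
  qed
qed

lemma dpi_eqI:
  assumes "f \<in> C0 M" "has_dpi M X f f'"
  shows "dpi M X f = f'"
proof -
  obtain B where B: "\<And>x. cmod (f x) \<le> B" using C0_bounded[OF assms(1)] by blast
  show ?thesis
    unfolding dpi_def
    by (rule the_equality[where P="has_dpi M X f", OF assms(2)]) (rule has_dpi_unique[OF B _ assms(2)])
qed

definition gauss_on :: "(real^'n) set \<Rightarrow> (real^'n \<Rightarrow> complex) \<Rightarrow> real^'n \<Rightarrow> complex" where
  "gauss_on M p = (\<lambda>m. if m \<in> M then gauss p m else 0)"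

lemma gauss_polynomials_eq: "gauss_polynomials M = gauss_on M ` {p. polynomial_function p}"
proof -
  have eq: "gauss_on M p = (\<lambda>m. (if m \<in> M then p m else 0) * complex_of_real (exp (- r2 m)))" for p
    by (auto simp: gauss_on_def gauss_def)
  show ?thesis
  proof (intro equalityI subsetI)
    fix g assume "g \<in> gauss_polynomials M"
    then obtain p where "polynomial_function p"
      "g = (\<lambda>m. (if m \<in> M then p m else 0) * complex_of_real (exp (- r2 m)))"
      by (auto simp only: gauss_polynomials_def polynomial_ring_on_def mem_Collect_eq)
    then show "g \<in> gauss_on M ` {p. polynomial_function p}"
      by (simp only: eq[symmetric]) (rule imageI, rule CollectI)
  next
    fix g assume "g \<in> gauss_on M ` {p. polynomial_function p}"
    then obtain p where "polynomial_function p"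
      "g = (\<lambda>m. (if m \<in> M then p m else 0) * complex_of_real (exp (- r2 m)))"
      by (auto simp only: eq)
    moreover then have "(\<lambda>m. if m \<in> M then p m else 0) \<in> polynomial_ring_on M"
      unfolding polynomial_ring_on_def by (intro CollectI exI[of _ p] conjI refl)
    ultimately show "g \<in> gauss_polynomials M"
      unfolding gauss_polynomials_def
      by (intro CollectI exI[of _ "\<lambda>m. if m \<in> M then p m else 0"] conjI)
  qed
qed

lemma gauss_on_C0:
  assumes M: "closed M" and p: "polynomial_function p"
  shows "gauss_on M p \<in> C0 M"
proof -
  have cont: "continuous_on S (gauss p)" for S
    using gauss_has_derivative[OF p] has_derivative_continuous
    by (intro continuous_at_imp_continuous_on) blast
  obtain C where C: "C \<ge> 0" "\<And>x. cmod (gauss p x) \<le> C * exp (- norm x)"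
    using gauss_decay[OF p] by blast
  have "compact {m\<in>M. \<epsilon> \<le> cmod (gauss_on M p m)}" if "\<epsilon> > 0" for \<epsilon>
  proof -
    have eq: "{m\<in>M. \<epsilon> \<le> cmod (gauss_on M p m)} = M \<inter> {m. \<epsilon> \<le> cmod (gauss p m)}"
      by (auto simp: gauss_on_def)
    have "norm m \<le> C / \<epsilon>" if "\<epsilon> \<le> cmod (gauss p m)" for m
    proof -
      have "\<epsilon> \<le> C / exp (norm m)"
        using C(2)[of m] that by (simp add: exp_minus divide_inverse)
      then have "exp (norm m) \<le> C / \<epsilon>"
        using \<open>\<epsilon> > 0\<close> by (simp add: field_simps)
      then show ?thesis using exp_ge_add_one_self[of "norm m"] by linarith
    qed
    then have "bounded {m. \<epsilon> \<le> cmod (gauss p m)}"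
      by (auto simp: bounded_iff)
    moreover have "closed {m. \<epsilon> \<le> cmod (gauss p m)}"
      by (intro closed_Collect_le continuous_intros cont)
    ultimately show ?thesis
      unfolding eq using M by (simp add: compact_eq_bounded_closed closed_Int bounded_Int)
  qed
  moreover have "continuous_on M (gauss_on M p)"
    using cont[of M] by (rule continuous_on_eq) (simp add: gauss_on_def)
  ultimately show ?thesis by (auto simp: C0_def gauss_on_def)
qed

lemma gauss_on_has_dpi:
  assumes M: "closed M" and p: "polynomial_function p"
    and stable: "\<And>t m. m \<in> M \<Longrightarrow> mexp (t *\<^sub>R X) *v m \<in> M"
  shows "has_dpi M X (gauss_on M p) (gauss_on M (gauss_deriv X p))"
proof -
  have p1: "polynomial_function (gauss_deriv X p)"
    using p by (rule polynomial_function_gauss_deriv)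
  obtain C where C: "C \<ge> 0" "\<And>x. cmod (gauss (gauss_deriv X (gauss_deriv X p)) x) \<le> C"
  proof -
    obtain C where C: "C \<ge> 0" "\<And>x. cmod (gauss (gauss_deriv X (gauss_deriv X p)) x) \<le> C * exp (- norm x)"
      using gauss_decay[OF polynomial_function_gauss_deriv[OF p1]] by blast
    have "C * exp (- norm x) \<le> C" for x :: "real^'n"
      using C(1) by (simp add: mult_left_le)
    then show ?thesis
      by (rule that[OF C(1) order_trans[OF C(2)]])
  qed
  define D where "D h = fscale (1 / complex_of_real h) (translate (mexp (h *\<^sub>R X)) (gauss_on M p) - gauss_on M p)
      - gauss_on M (gauss_deriv X p)" for h
  have D: "cmod (D h m) \<le> 3 * C * \<bar>h\<bar>" if "m \<in> M" "h \<noteq> 0" for h m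
  proof -
    define u where "u t = gauss p (mexp (t *\<^sub>R - X) *v m)" for t
    define u' where "u' t = gauss (gauss_deriv X p) (mexp (t *\<^sub>R - X) *v m)" for t
    have "cmod (u h - u 0 - h *\<^sub>R u' 0) \<le> 3 * C * h\<^sup>2"
      unfolding u_def u'_def
      by (rule second_order_bound[OF gauss_flow_has_vector_derivative[OF p]
            gauss_flow_has_vector_derivative[OF p1]]) (rule C)
    moreover have "u h - u 0 - h *\<^sub>R u' 0 = complex_of_real h * D h m"
    proof -
      have "mexp (- (h *\<^sub>R X)) *v m \<in> M"
        using stable[OF \<open>m \<in> M\<close>, of "- h"] by simp
      then show ?thesis
        using that
        by (simp add: D_def u_def u'_def fscale_def translate_def gauss_on_def matrix_inv_mexp
            scaleR_conv_of_real right_diff_distrib)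
    qed
    ultimately have "\<bar>h\<bar> * cmod (D h m) \<le> \<bar>h\<bar> * (3 * C * \<bar>h\<bar>)"
      by (simp add: norm_mult power2_eq_square mult_ac abs_mult_self_eq)
    then show ?thesis using \<open>h \<noteq> 0\<close> by simp
  qed
  have "((\<lambda>h. sup_norm M (D h)) \<longlongrightarrow> 0) (at 0)"
  proof (rule Lim_null_comparison)
    have "norm (sup_norm M (D h)) \<le> 3 * C * \<bar>h\<bar>" if "h \<noteq> 0" for h
      using sup_norm_bounds(1,3)[of M "D h" "3 * C * \<bar>h\<bar>"] D[OF _ that] C(1) by simp
    then show "\<forall>\<^sub>F h in at 0. norm (sup_norm M (D h)) \<le> 3 * C * \<bar>h\<bar>"
      by (auto simp: eventually_at_filter)
    show "((\<lambda>h. 3 * C * \<bar>h\<bar>) \<longlongrightarrow> 0) (at 0)"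
      by (auto intro!: tendsto_eq_intros)
  qed
  then show ?thesis
    unfolding has_dpi_def D_def using gauss_on_C0[OF M p1] by blast
qed

text \<open>Elements of \<open>C0 M\<close> vanish off \<open>M\<close>, so stability of \<open>M\<close> is needed in both directions.\<close>

context
  fixes M :: "(real^'n) set" and k :: "real^'n^'n"
  assumes inv: "invertible k" and stable: "\<And>m. k *v m \<in> M \<longleftrightarrow> m \<in> M"
begin

lemma matrix_inv_cancel: "k *v (matrix_inv k *v m) = m" "matrix_inv k *v (k *v m) = m"
  by (simp_all add: matrix_vector_mul_assoc matrix_inv_right matrix_inv_left inv)

lemma stable_inv: "matrix_inv k *v m \<in> M \<longleftrightarrow> m \<in> M"
  using stable[of "matrix_inv k *v m"] by (simp add: matrix_inv_cancel)

lemma translate_C0: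
  assumes "f \<in> C0 M"
  shows "translate k f \<in> C0 M"
proof -
  have "compact {m\<in>M. \<epsilon> \<le> cmod (translate k f m)}" if "\<epsilon> > 0" for \<epsilon>
  proof -
    have "{m\<in>M. \<epsilon> \<le> cmod (translate k f m)} = (*v) k ` {m\<in>M. \<epsilon> \<le> cmod (f m)}"
    proof (intro Set.set_eqI iffI)
      fix m assume "m \<in> {m\<in>M. \<epsilon> \<le> cmod (translate k f m)}"
      then show "m \<in> (*v) k ` {m\<in>M. \<epsilon> \<le> cmod (f m)}"
        by (intro image_eqI[of _ _ "matrix_inv k *v m"])
          (auto simp: translate_def matrix_inv_cancel stable_inv)
    qed (auto simp: translate_def matrix_inv_cancel stable)
    moreover have "compact ((*v) k ` {m\<in>M. \<epsilon> \<le> cmod (f m)})"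
      using assms that
      by (intro compact_continuous_image matrix_vector_mult_linear_continuous_on) (auto simp: C0_def)
    ultimately show ?thesis by simp
  qed
  moreover have "continuous_on M (translate k f)"
    unfolding translate_def
    by (rule continuous_on_compose2[of M f])
      (use assms in \<open>auto simp: C0_def stable_inv intro: matrix_vector_mult_linear_continuous_on\<close>)
  ultimately show ?thesis
    using assms by (auto simp: C0_def) (auto simp: translate_def stable_inv)
qed

lemma sup_norm_translate: "sup_norm M (translate k f) = sup_norm M f"
proof -
  have "(\<lambda>m. cmod (translate k f m)) ` M = (\<lambda>m. cmod (f m)) ` M"
  proof (intro Set.set_eqI iffI)
    fix y assume "y \<in> (\<lambda>m. cmod (f m)) ` M"
    then obtain m where "m \<in> M" "y = cmod (f m)" by blast
    then show "y \<in> (\<lambda>m. cmod (translate k f m)) ` M"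
      by (intro image_eqI[of _ _ "k *v m"]) (auto simp: translate_def matrix_inv_cancel stable)
  qed (auto simp: translate_def stable_inv)
  then show ?thesis by (simp add: sup_norm_def)
qed

lemma has_dpi_translate:
  assumes "has_dpi M X f f'"
  shows "has_dpi M (Ad k X) (translate k f) (translate k f')"
proof -
  have "translate (mexp (h *\<^sub>R Ad k X)) (translate k f) = translate k (translate (mexp (h *\<^sub>R X)) f)" for h
  proof -
    have "- (h *\<^sub>R Ad k X) = k ** (- (h *\<^sub>R X)) ** matrix_inv k"
      unfolding Ad_def scaleR_minus_left[symmetric]
      by (simp only: bounded_bilinear.scaleR_left[OF bounded_bilinear_matrix_mult]
          bounded_bilinear.scaleR_right[OF bounded_bilinear_matrix_mult])
    then have "matrix_inv (mexp (h *\<^sub>R Ad k X)) = k ** mexp (- (h *\<^sub>R X)) ** matrix_inv k"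
      by (simp only: matrix_inv_mexp mexp_conjugate matrix_inv_right matrix_inv_left inv)
    then have "matrix_inv k *v (matrix_inv (mexp (h *\<^sub>R Ad k X)) *v m)
        = matrix_inv (mexp (h *\<^sub>R X)) *v (matrix_inv k *v m)" for m
      by (simp only: matrix_inv_mexp matrix_vector_mul_assoc[symmetric] matrix_inv_cancel)
    then show ?thesis
      unfolding translate_def by presburger
  qed
  then have eq: "fscale (1 / complex_of_real h) (translate (mexp (h *\<^sub>R Ad k X)) (translate k f) - translate k f) - translate k f'
    = translate k (fscale (1 / complex_of_real h) (translate (mexp (h *\<^sub>R X)) f - f) - f')" for h
    by (simp only:) (simp add: fscale_def translate_def fun_eq_iff)
  have f': "f' \<in> C0 M" and lim: "((\<lambda>h::real. sup_norm M
      (fscale (1 / complex_of_real h) (translate (mexp (h *\<^sub>R X)) f - f) - f')) \<longlongrightarrow> 0) (at 0)"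
    by (rule has_dpi_C0[OF assms], rule has_dpi_tendsto[OF assms])
  show ?thesis
    unfolding has_dpi_def
  proof (rule conjI)
    show "((\<lambda>h::real. sup_norm M (fscale (1 / complex_of_real h)
        (translate (mexp (h *\<^sub>R Ad k X)) (translate k f) - translate k f) - translate k f')) \<longlongrightarrow> 0) (at 0)"
      by (subst eq) (subst sup_norm_translate, rule lim)
  qed (rule translate_C0[OF f'])
qed

end

section \<open>Finite-dimensional complex spaces with the weak topology\<close>

lemma continuous_map_mult_complex:
  fixes f g :: "'a \<Rightarrow> complex"
  shows "continuous_map X euclidean f \<Longrightarrow> continuous_map X euclidean g \<Longrightarrow>
    continuous_map X euclidean (\<lambda>x. f x * g x)"
  by (simp add: continuous_map_atin tendsto_mult)

context vector_space
begin

lemma finite_spanning_subset: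
  assumes "finite T" "S \<subseteq> span T"
  shows "\<exists>B\<subseteq>S. finite B \<and> independent B \<and> span B = span S"
proof -
  obtain B where B: "B \<subseteq> S" "independent B" "S \<subseteq> span B"
    using maximal_independent_subset[of S] by metis
  have "finite B"
    using independent_span_bound[OF assms(1) B(2)] B(1) assms(2) by blast
  moreover have "span B = span S"
    using B(1,3) span_mono span_minimal[OF B(3) subspace_span] by (intro equalityI) auto
  ultimately show ?thesis using B by blast
qed

end

locale complex_vector_space = vector_space sc for sc :: "complex \<Rightarrow> 'v \<Rightarrow> 'v::ab_group_add"
begin

abbreviation functional :: "('v \<Rightarrow> complex) \<Rightarrow> bool" where
  "functional \<equiv> Vector_Spaces.linear sc (*)"

abbreviation weak :: "'v set \<Rightarrow> 'v topology" where
  "weak \<equiv> fin_dim_topology sc"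

sublocale functionals: vector_space_pair sc "(*) :: complex \<Rightarrow> complex \<Rightarrow> complex" ..

lemma topspace_weak [simp]: "topspace (weak W) = W"
proof -
  have "functional (\<lambda>v. 0)" by (rule functionals.module_hom_zero)
  then have "{w \<in> W. (\<lambda>v. 0::complex) w \<in> UNIV} \<in> {{w \<in> W. f w \<in> U} | f U. functional f \<and> open U}"
    by blast
  then show ?thesis
    unfolding fin_dim_topology_def topology_generated_by_topspace by auto
qed

lemma continuous_map_functional:
  assumes "functional l"
  shows "continuous_map (weak W) euclidean l"
  unfolding continuous_map_def
proof (intro conjI allI impI)
  fix U :: "complex set" assume "openin euclidean U"
  then have "{w \<in> W. l w \<in> U} \<in> {{w \<in> W. f w \<in> U} | f U. functional f \<and> open U}"
    using assms by auto
  then show "openin (weak W) {x \<in> topspace (weak W). l x \<in> U}"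
    unfolding topspace_weak by (subst fin_dim_topology_def) (rule topology_generated_by_Basis)
qed simp

lemma continuous_map_into_weak:
  assumes "\<And>x. x \<in> topspace T \<Longrightarrow> g x \<in> W"
    and "\<And>l. functional l \<Longrightarrow> continuous_map T euclidean (\<lambda>x. l (g x))"
  shows "continuous_map T (weak W) g"
  unfolding fin_dim_topology_def
proof (rule continuous_on_generated_topo)
  fix V assume "V \<in> {{w \<in> W. f w \<in> U} | f U. functional f \<and> open U}"
  then obtain l U where lU: "V = {w \<in> W. l w \<in> U}" "functional l" "open U" by blast
  have "openin T {x \<in> topspace T. l (g x) \<in> U}"
    using assms(2)[OF lU(2)] lU(3) by (simp add: continuous_map_def)
  moreover have "{x \<in> topspace T. l (g x) \<in> U} = g -` V \<inter> topspace T"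
    using assms(1) lU(1) by auto
  ultimately show "openin T (g -` V \<inter> topspace T)" by simp
next
  have "g ` topspace T \<subseteq> topspace (weak W)" using assms(1) by auto
  then show "g ` topspace T \<subseteq> \<Union> {{w \<in> W. f w \<in> U} | f U. functional f \<and> open U}"
    unfolding fin_dim_topology_def topology_generated_by_topspace .
qed

lemma limitin_weak:
  assumes W: "w \<in> W" "\<forall>\<^sub>F t in F. g t \<in> W"
    and lim: "\<And>l. functional l \<Longrightarrow> ((\<lambda>t. l (g t)) \<longlongrightarrow> l w) F"
  shows "limitin (weak W) g w F"
  unfolding limitin_def
proof (intro conjI allI impI)
  fix V assume "openin (weak W) V \<and> w \<in> V"
  then have "generate_topology_on {{w \<in> W. f w \<in> U} | f U. functional f \<and> open U} V" "w \<in> V"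
    by (simp_all add: fin_dim_topology_def openin_topology_generated_by_iff)
  then show "\<forall>\<^sub>F t in F. g t \<in> V"
  proof induction
    case (Int a b)
    then show ?case by (auto intro: eventually_conj)
  next
    case (UN K)
    then obtain k where k: "k \<in> K" "w \<in> k" by blast
    then have "\<forall>\<^sub>F t in F. g t \<in> k" using UN by blast
    then show ?case by (rule eventually_mono) (use k in blast)
  next
    case (Basis V)
    then obtain l U where lU: "V = {w \<in> W. l w \<in> U}" "functional l" "open U" by blast
    then have "\<forall>\<^sub>F t in F. l (g t) \<in> U"
      using topological_tendstoD[OF lim[OF lU(2)] lU(3)] Basis by blast
    with W(2) show ?case unfolding lU(1) by eventually_elim simp
  qed simp
qed (simp add: W)

lemma coordinates_exist:
  assumes "finite B" "independent B"
  obtains \<phi> where "\<And>b. functional (\<phi> b)" "\<And>w. w \<in> span B \<Longrightarrow> w = (\<Sum>b\<in>B. sc (\<phi> b w) b)"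
proof -
  have "\<exists>g. functional g \<and> (\<forall>x\<in>B. g x = (if x = b then 1 else 0))" for b
    by (rule functionals.linear_independent_extend[OF assms(2)])
  then obtain \<phi> where \<phi>: "\<And>b. functional (\<phi> b)" "\<And>b x. x \<in> B \<Longrightarrow> \<phi> b x = (if x = b then 1 else 0)"
    by metis
  have "w = (\<Sum>b\<in>B. sc (\<phi> b w) b)" if "w \<in> span B" for w
  proof -
    obtain u where u: "w = (\<Sum>v\<in>B. sc (u v) v)"
      using \<open>w \<in> span B\<close> span_finite[OF assms(1)] by auto
    have "\<phi> b w = u b" if "b \<in> B" for b
    proof -
      have "\<phi> b w = (\<Sum>v\<in>B. u v * \<phi> b v)"
        unfolding u by (simp add: functionals.linear_sum[OF \<phi>(1)] functionals.linear_scale[OF \<phi>(1)])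
      also have "\<dots> = u b"
        using that assms(1) by (simp add: \<phi>(2) if_distrib cong: if_cong)
      finally show ?thesis .
    qed
    then show ?thesis using u by simp
  qed
  with \<phi>(1) show ?thesis by (rule that)
qed

lemma continuous_map_action:
  assumes B: "finite B" "independent B"
    and lin: "\<And>k. k \<in> K \<Longrightarrow> Vector_Spaces.linear sc sc (\<rho> k)"
    and invariant: "\<And>k w. k \<in> K \<Longrightarrow> w \<in> span B \<Longrightarrow> \<rho> k w \<in> span B"
    and cont: "\<And>b l. b \<in> B \<Longrightarrow> functional l \<Longrightarrow> continuous_on K (\<lambda>k. l (\<rho> k b))"
  shows "continuous_map (prod_topology (top_of_set K) (weak (span B))) (weak (span B)) (\<lambda>(k, w). \<rho> k w)"
proof (rule continuous_map_into_weak)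
  fix l assume l: "functional l"
  obtain \<phi> where \<phi>: "\<And>b. functional (\<phi> b)" "\<And>w. w \<in> span B \<Longrightarrow> w = (\<Sum>b\<in>B. sc (\<phi> b w) b)"
    using coordinates_exist[OF B] by blast
  let ?T = "prod_topology (top_of_set K) (weak (span B))"
  have "continuous_map ?T euclidean (\<lambda>x. \<Sum>b\<in>B. \<phi> b (snd x) * l (\<rho> (fst x) b))"
  proof (intro continuous_map_sum B(1) continuous_map_mult_complex)
    fix b assume b: "b \<in> B"
    show "continuous_map ?T euclidean (\<lambda>x. \<phi> b (snd x))"
      using continuous_map_compose[OF continuous_map_snd continuous_map_functional[OF \<phi>(1)]]
      by (simp add: o_def)
    have "continuous_map (top_of_set K) euclidean (\<lambda>k. l (\<rho> k b))"
      using cont[OF b l] by simp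
    from continuous_map_compose[OF continuous_map_fst this]
    show "continuous_map ?T euclidean (\<lambda>x. l (\<rho> (fst x) b))"
      by (simp add: o_def)
  qed
  moreover have "(\<Sum>b\<in>B. \<phi> b (snd x) * l (\<rho> (fst x) b)) = l (case x of (k, w) \<Rightarrow> \<rho> k w)"
    if x: "x \<in> topspace ?T" for x
  proof -
    obtain k w where kw: "x = (k, w)" "k \<in> K" "w \<in> span B"
      using x by (cases x) auto
    interpret \<rho>: Vector_Spaces.linear sc sc "\<rho> k" by (rule lin[OF kw(2)])
    interpret l: Vector_Spaces.linear sc "(*)" l by (rule l)
    have "\<rho> k w = \<rho> k (\<Sum>b\<in>B. sc (\<phi> b w) b)"
      using \<phi>(2)[OF kw(3)] by (rule arg_cong)
    then show ?thesis
      by (simp add: kw \<rho>.sum \<rho>.scale l.sum l.scale)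
  qed
  ultimately show "continuous_map ?T euclidean (\<lambda>x. l (case x of (k, w) \<Rightarrow> \<rho> k w))"
    by (rule continuous_map_eq)
qed (use invariant in auto)

text \<open>In a finite-dimensional space the weak limit exists because its coordinates do; the separating
  functionals in \<open>L\<close> identify it.\<close>

lemma limitin_weak_of_functionals:
  assumes B: "finite B" "independent B"
    and g: "\<forall>\<^sub>F t in F. g t \<in> span B"
    and lim: "\<And>l. functional l \<Longrightarrow> \<exists>c. ((\<lambda>t. l (g t)) \<longlongrightarrow> c) F"
    and sep: "\<And>l. l \<in> L \<Longrightarrow> functional l \<and> ((\<lambda>t. l (g t)) \<longlongrightarrow> l w) F"
      "\<And>v. (\<And>l. l \<in> L \<Longrightarrow> l v = l w) \<Longrightarrow> v = w"
    and F: "F \<noteq> bot"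
  shows "limitin (weak (span B)) g w F"
proof -
  obtain \<phi> where \<phi>: "\<And>b. functional (\<phi> b)" "\<And>w. w \<in> span B \<Longrightarrow> w = (\<Sum>b\<in>B. sc (\<phi> b w) b)"
    using coordinates_exist[OF B] by blast
  obtain d where d: "\<And>b. ((\<lambda>t. \<phi> b (g t)) \<longlongrightarrow> d b) F"
    using lim[OF \<phi>(1)] by metis
  define u where "u = (\<Sum>b\<in>B. sc (d b) b)"
  have u: "((\<lambda>t. l (g t)) \<longlongrightarrow> l u) F" if l: "functional l" for l
  proof -
    interpret l: Vector_Spaces.linear sc "(*)" l by (rule l)
    have "((\<lambda>t. \<Sum>b\<in>B. \<phi> b (g t) * l b) \<longlongrightarrow> (\<Sum>b\<in>B. d b * l b)) F"
      by (intro tendsto_sum tendsto_mult d tendsto_const)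
    moreover have "\<forall>\<^sub>F t in F. (\<Sum>b\<in>B. \<phi> b (g t) * l b) = l (g t)"
      using g
    proof (rule eventually_mono)
      fix t assume "g t \<in> span B"
      then have "l (g t) = l (\<Sum>b\<in>B. sc (\<phi> b (g t)) b)"
        using \<phi>(2) by (intro arg_cong[where f=l]) blast
      then show "(\<Sum>b\<in>B. \<phi> b (g t) * l b) = l (g t)"
        by (simp add: l.sum l.scale)
    qed
    moreover have "l u = (\<Sum>b\<in>B. d b * l b)"
      by (simp add: u_def l.sum l.scale)
    ultimately show ?thesis by (simp add: Lim_transform_eventually)
  qed
  have "u = w"
    by (rule sep(2)) (use sep(1) u tendsto_unique[OF F] in blast)
  moreover have "u \<in> span B"
    unfolding u_def by (intro span_sum span_scale span_base)
  ultimately show ?thesis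
    using g u by (intro limitin_weak) auto
qed

end

section \<open>Linear substitutions in polynomials\<close>

inductive separated :: "('a::real_normed_vector \<Rightarrow> 'b \<Rightarrow> complex) \<Rightarrow> bool" where
  prod: "(\<And>A. c differentiable (at A)) \<Longrightarrow> separated (\<lambda>A x. c A * b x)"
| add: "separated f \<Longrightarrow> separated g \<Longrightarrow> separated (\<lambda>A x. f A x + g A x)"

lemma separated_const: "separated (\<lambda>A x. b x)"
  using separated.prod[of "\<lambda>_. 1" b] by simp

lemma separated_sum:
  "finite I \<Longrightarrow> (\<And>i. i \<in> I \<Longrightarrow> separated (f i)) \<Longrightarrow> separated (\<lambda>A x. \<Sum>i\<in>I. f i A x)"
proof (induction I rule: finite_induct)
  case empty
  then show ?case using separated_const[of "\<lambda>_. 0"] by simp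
next
  case (insert i I)
  then have "separated (\<lambda>A x. f i A x + (\<Sum>i\<in>I. f i A x))"
    by (intro separated.add) auto
  then show ?case using insert by simp
qed

lemma separated_mult:
  assumes "separated f" "separated g"
  shows "separated (\<lambda>A x. f A x * g A x)"
  using assms(1)
proof induction
  case (prod c b)
  from assms(2) show ?case
  proof induction
    case (prod d e)
    have "separated (\<lambda>A x. (c A * d A) * (b x * e x))"
      using prod \<open>\<And>A. c differentiable (at A)\<close> by (intro separated.prod differentiable_mult)
    then show ?case by (simp only: mult.assoc mult.left_commute)
  next
    case (add f g)
    from separated.add[OF add.IH] show ?case by (simp only: distrib_left)
  qed
next
  case (add f h)
  from separated.add[OF add.IH] show ?case by (simp only: distrib_right)
qed

lemma separated_polynomial_substitution:
  fixes p :: "real^'n \<Rightarrow> complex"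
  assumes "polynomial_function p"
  shows "separated (\<lambda>(A :: real^'n^'n) x. p (A *v x))"
  using assms
proof (induction p rule: complex_polynomial_induct)
  case (const c)
  show ?case by (rule separated_const)
next
  case (linear f)
  have "separated (\<lambda>(A :: real^'n^'n) x. \<Sum>i\<in>UNIV. complex_of_real (f (A *v axis i 1)) * complex_of_real (x $ i))"
  proof (intro separated_sum separated.prod finite)
    have "bounded_linear (\<lambda>A :: real^'n^'n. complex_of_real (f (A *v axis i 1)))" for i
      by (rule bounded_linear_compose[OF bounded_linear_of_real bounded_linear_compose[OF linear
            bounded_bilinear.bounded_linear_left[OF bounded_bilinear_matrix_vector_mult]]])
    then show "(\<lambda>A. complex_of_real (f (A *v axis i 1))) differentiable (at B)" for i and B :: "real^'n^'n"
      by (rule bounded_linear_imp_differentiable)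
  qed
  moreover have eq: "complex_of_real (f (A *v x)) =
      (\<Sum>i\<in>UNIV. complex_of_real (f (A *v axis i 1)) * complex_of_real (x $ i))" for A :: "real^'n^'n" and x
  proof -
    have "A *v x = (\<Sum>i\<in>UNIV. (x $ i) *\<^sub>R (A *v axis i 1))"
      by (simp only: matrix_vector_mult_basis matrix_mult_sum[of A x] scalar_mult_eq_scaleR)
    then have "f (A *v x) = (\<Sum>i\<in>UNIV. (x $ i) *\<^sub>R f (A *v axis i 1))"
      using bounded_linear.linear[OF linear] by (simp add: linear_sum linear_scale)
    then show ?thesis by (simp add: mult.commute)
  qed
  ultimately show ?case
    by (intro ssubst[where P=separated, OF ext[OF ext[OF eq]]])
next
  case (add f g)
  then show ?case by (intro separated.add)
next
  case (mult f g)
  then show ?case by (intro separated_mult)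
qed

interpretation fscale: complex_vector_space fscale
  by unfold_locales (simp_all add: fscale_def fun_eq_iff algebra_simps)

lemma gauss_on_add: "gauss_on M (\<lambda>m. p m + q m) = gauss_on M p + gauss_on M q"
  by (simp add: gauss_on_def gauss_def fun_eq_iff distrib_right)

lemma gauss_on_cmult: "gauss_on M (\<lambda>m. c * p m) = fscale c (gauss_on M p)"
  by (simp add: gauss_on_def gauss_def fscale_def fun_eq_iff mult.assoc)

lemma gauss_on_diff: "gauss_on M (\<lambda>m. p m - q m) = gauss_on M p - gauss_on M q"
  by (simp add: gauss_on_def gauss_def fun_eq_iff left_diff_distrib)

lemma gauss_on_separated_finite_span:
  "separated f \<Longrightarrow> \<exists>B. finite B \<and> (\<forall>A. gauss_on M (f A) \<in> fscale.span B)"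
proof (induction rule: separated.induct)
  case (prod c b)
  have "gauss_on M (\<lambda>x. c A * b x) \<in> fscale.span {gauss_on M b}" for A
    unfolding gauss_on_cmult by (intro fscale.span_scale fscale.span_base) simp
  then show ?case by (intro exI[of _ "{gauss_on M b}"]) simp
next
  case (add f g)
  then obtain B C where BC: "finite B" "finite C" "\<And>A. gauss_on M (f A) \<in> fscale.span B"
    "\<And>A. gauss_on M (g A) \<in> fscale.span C" by blast
  have "gauss_on M (\<lambda>x. f A x + g A x) \<in> fscale.span (B \<union> C)" for A
    unfolding gauss_on_add
    using BC(3)[of A] BC(4)[of A] fscale.span_mono[of B "B \<union> C"] fscale.span_mono[of C "B \<union> C"]
    by (intro fscale.span_add) auto
  then show ?case using BC by (intro exI[of _ "B \<union> C"]) simp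
qed

lemma gauss_on_separated_differentiable:
  assumes "fscale.functional l"
  shows "separated f \<Longrightarrow> (\<lambda>A. l (gauss_on M (f A))) differentiable (at A)"
proof (induction rule: separated.induct)
  case (prod c b)
  have "l (gauss_on M (\<lambda>x. c A * b x)) = c A * l (gauss_on M b)" for A
    unfolding gauss_on_cmult by (rule fscale.functionals.linear_scale[OF assms])
  with prod show ?case by simp
next
  case (add f g)
  have "l (gauss_on M (\<lambda>x. f A x + g A x)) = l (gauss_on M (f A)) + l (gauss_on M (g A))" for A
    unfolding gauss_on_add by (rule fscale.functionals.linear_add[OF assms])
  with add show ?case by simp
qed

lemma continuous_on_matrix_inv:
  fixes K :: "(real^'n^'n) set"
  assumes "compact K" "subgroup K GL"
  shows "continuous_on K matrix_inv"
proof -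
  interpret mm: bounded_bilinear "(**) :: real^'n^'n \<Rightarrow> real^'n^'n \<Rightarrow> real^'n^'n"
    by (rule bounded_bilinear_matrix_mult)
  have "\<exists>C>0. \<forall>(A :: real^'n^'n) (B :: real^'n^'n). norm (A ** B) \<le> norm A * norm B * C"
    by (rule mm.pos_bounded)
  then obtain C where C: "C > 0" "\<And>(A :: real^'n^'n) (B :: real^'n^'n). norm (A ** B) \<le> norm A * norm B * C"
    by blast
  obtain R where R: "R > 0" "\<And>A. A \<in> K \<Longrightarrow> norm A \<le> R"
    using compact_imp_bounded[OF assms(1)] by (auto simp: bounded_pos)
  have "dist (matrix_inv A) (matrix_inv B) \<le> (R * R * C * C) * dist A B" if AB: "A \<in> K" "B \<in> K" for A B
  proof -
    have A: "matrix_inv A ** A = mat 1" and B: "B ** matrix_inv B = mat 1"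
      using AB by (simp_all add: matrix_inv_right matrix_inv_left subgroup_GL_invertible[OF assms(2)])
    have "matrix_inv A ** (B - A) ** matrix_inv B
        = matrix_inv A ** (B ** matrix_inv B) - (matrix_inv A ** A) ** matrix_inv B"
      by (simp only: mm.diff_right mm.diff_left matrix_mul_assoc)
    also have "\<dots> = matrix_inv A - matrix_inv B"
      unfolding A B by simp
    finally have eq: "matrix_inv A - matrix_inv B = matrix_inv A ** (B - A) ** matrix_inv B" by simp
    have inv: "norm (matrix_inv A) \<le> R" "norm (matrix_inv B) \<le> R"
      using AB by (simp_all add: R subgroup_GL_matrix_inv[OF assms(2)])
    have "norm (matrix_inv A ** (B - A) ** matrix_inv B)
        \<le> (norm (matrix_inv A) * norm (B - A) * C) * norm (matrix_inv B) * C"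
      using C by (intro order_trans[OF C(2)] mult_right_mono) auto
    also have "\<dots> \<le> (R * norm (B - A) * C) * R * C"
      using inv R C by (intro mult_right_mono mult_mono) auto
    finally show ?thesis
      by (simp add: dist_norm eq norm_minus_commute mult_ac)
  qed
  moreover have "0 \<le> R * R * C * C" using R C by simp
  ultimately have "(R * R * C * C)-lipschitz_on K matrix_inv"
    by (intro lipschitz_onI)
  then show ?thesis by (rule lipschitz_on_continuous_on)
qed

lemma linear_translate: "Vector_Spaces.linear fscale fscale (translate k)"
  by unfold_locales (simp_all add: fscale_def translate_def fun_eq_iff)

lemma linear_evaluation: "fscale.functional (\<lambda>v. v x)"
  by unfold_locales (simp_all add: fscale_def)

section \<open>The Harish-Chandra module\<close>

locale affine_action =
  fixes G K :: "(real^'n^'n) set" and M :: "(real^'n) set"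
  assumes G: "real_linear_algebraic_group G"
    and K: "subgroup K GL" "K \<subseteq> G" "compact K"
    and M: "closed M"
    and action: "\<And>g m. g \<in> G \<Longrightarrow> m \<in> M \<Longrightarrow> g *v m \<in> M"
    and invariant: "\<And>k m. k \<in> K \<Longrightarrow> m \<in> M \<Longrightarrow> r2 (k *v m) = r2 m"
begin

lemma subgroup_G: "subgroup G GL"
  using G by (simp add: real_linear_algebraic_group_def)

lemma action_iff:
  assumes "g \<in> G"
  shows "g *v m \<in> M \<longleftrightarrow> m \<in> M"
proof
  assume "g *v m \<in> M"
  then have "matrix_inv g *v (g *v m) \<in> M"
    by (rule action[OF subgroup_GL_matrix_inv[OF subgroup_G assms]])
  then show "m \<in> M"
    using subgroup_GL_invertible[OF subgroup_G assms] by (simp add: matrix_vector_mul_assoc matrix_inv_left)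
qed (rule action[OF assms])

lemma lie_algebra_K_G: "lie_algebra K \<subseteq> lie_algebra G"
  using K(2) by (auto simp: lie_algebra_def)

lemma gauss_has_dpi:
  assumes "X \<in> lie_algebra G" "polynomial_function p"
  shows "has_dpi M X (gauss_on M p) (gauss_on M (gauss_deriv X p))"
  using assms by (intro gauss_on_has_dpi M action) (simp_all add: lie_algebra_def)

lemma dpi_gauss:
  assumes "X \<in> lie_algebra G" "polynomial_function p"
  shows "dpi M X (gauss_on M p) = gauss_on M (gauss_deriv X p)"
  by (rule dpi_eqI[OF gauss_on_C0[OF M assms(2)] gauss_has_dpi[OF assms]])

lemma translate_gauss:
  assumes "k \<in> K"
  shows "translate k (gauss_on M p) = gauss_on M (\<lambda>m. p (matrix_inv k *v m))"
proof -
  have k: "matrix_inv k \<in> K" "matrix_inv k \<in> G"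
    using subgroup_GL_matrix_inv[OF K(1) assms] K(2) by auto
  show ?thesis
    by (auto simp: translate_def gauss_on_def gauss_def fun_eq_iff action_iff[OF k(2)] invariant[OF k(1)])
qed

lemma polynomial_function_substitution:
  "polynomial_function p \<Longrightarrow> polynomial_function (\<lambda>m. p (A *v m))"
  for p :: "real^'n \<Rightarrow> complex" and A :: "real^'n^'n"
  using polynomial_function_compose[of "(*v) A" p]
  by (simp add: o_def polynomial_function_bounded_linear matrix_vector_mul_bounded_linear)

abbreviation P :: "(real^'n \<Rightarrow> complex) set" where
  "P \<equiv> gauss_polynomials M"

lemma P_cases:
  assumes "v \<in> P"
  obtains p where "polynomial_function p" "v = gauss_on M p"
  using assms by (auto simp: gauss_polynomials_eq)

lemma P_I: "polynomial_function p \<Longrightarrow> gauss_on M p \<in> P"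
  by (simp add: gauss_polynomials_eq)

lemma translate_P:
  assumes "k \<in> K" "v \<in> P"
  shows "translate k v \<in> P"
  using assms(2)
  by (rule P_cases) (simp add: translate_gauss[OF assms(1)] P_I polynomial_function_substitution)

lemma dpi_P:
  assumes "X \<in> lie_algebra G" "v \<in> P"
  shows "dpi M X v \<in> P"
  using assms(2)
  by (rule P_cases) (simp add: dpi_gauss[OF assms(1)] P_I polynomial_function_gauss_deriv)

lemma functional_orbit_differentiable:
  fixes A :: "real^'n^'n"
  assumes "fscale.functional l" "polynomial_function p"
  shows "(\<lambda>A. l (gauss_on M (\<lambda>m. p (A *v m)))) differentiable (at A)"
  by (rule gauss_on_separated_differentiable[OF assms(1) separated_polynomial_substitution[OF assms(2)]])

abbreviation orbit :: "(real^'n \<Rightarrow> complex) \<Rightarrow> (real^'n \<Rightarrow> complex) set" where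
  "orbit v \<equiv> (\<lambda>k. translate k v) ` K"

lemma orbit_basis:
  assumes "v \<in> P"
  obtains B where "B \<subseteq> orbit v" "finite B" "fscale.independent B" "fscale.span B = fscale.span (orbit v)"
proof -
  obtain p where p: "polynomial_function p" "v = gauss_on M p" using assms by (rule P_cases)
  obtain T where "finite T" "\<And>A. gauss_on M (\<lambda>m. p (A *v m)) \<in> fscale.span T"
    using gauss_on_separated_finite_span[OF separated_polynomial_substitution[OF p(1)]] by blast
  then have "orbit v \<subseteq> fscale.span T"
    by (auto simp: p(2) translate_gauss)
  from fscale.finite_spanning_subset[OF \<open>finite T\<close> this] that show ?thesis by blast
qed

lemma translate_mult:
  assumes "k \<in> K" "l \<in> K"
  shows "translate (k ** l) v = translate k (translate l v)"
proof -
  have inv: "invertible k" "invertible l"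
    using assms subgroup_GL_invertible[OF K(1)] by auto
  have "matrix_inv (k ** l) = matrix_inv l ** matrix_inv k"
  proof (rule matrix_inv_eqI)
    have "k ** l ** (matrix_inv l ** matrix_inv k) = k ** (l ** matrix_inv l) ** matrix_inv k"
      "matrix_inv l ** matrix_inv k ** (k ** l) = matrix_inv l ** (matrix_inv k ** k) ** l"
      by (simp_all only: matrix_mul_assoc)
    then show "k ** l ** (matrix_inv l ** matrix_inv k) = mat 1"
      "matrix_inv l ** matrix_inv k ** (k ** l) = mat 1"
      using inv by (simp_all add: matrix_inv_right matrix_inv_left)
  qed
  then show ?thesis by (simp add: translate_def matrix_vector_mul_assoc)
qed

lemma span_orbit_invariant:
  assumes "k \<in> K" "w \<in> fscale.span (orbit v)"
  shows "translate k w \<in> fscale.span (orbit v)"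
proof -
  interpret t: Vector_Spaces.linear fscale fscale "translate k" by (rule linear_translate)
  have "translate k ` orbit v \<subseteq> orbit v"
    using assms(1) by (auto simp: translate_mult[symmetric] subgroup_GL_mult[OF K(1)])
  then have "fscale.span (translate k ` orbit v) \<subseteq> fscale.span (orbit v)"
    by (rule fscale.span_mono)
  with assms(2) show ?thesis by (auto simp: t.span_image)
qed

lemma continuous_map_orbit:
  assumes "v \<in> P"
  shows "continuous_map (prod_topology (top_of_set K) (fscale.weak (fscale.span (orbit v))))
    (fscale.weak (fscale.span (orbit v))) (\<lambda>(k, w). translate k w)"
proof -
  obtain B where B: "B \<subseteq> orbit v" "finite B" "fscale.independent B" "fscale.span B = fscale.span (orbit v)"
    using orbit_basis[OF assms] .
  have "continuous_on K (\<lambda>k. l (translate k b))" if b: "b \<in> B" and l: "fscale.functional l" for b l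
  proof -
    have "b \<in> P" using B(1) b translate_P[OF _ assms] by blast
    then obtain q where q: "polynomial_function q" "b = gauss_on M q" by (rule P_cases)
    have "continuous_on UNIV (\<lambda>A. l (gauss_on M (\<lambda>m. q (A *v m))))"
      using functional_orbit_differentiable[OF l q(1)]
      by (simp add: continuous_on_eq_continuous_at differentiable_imp_continuous_within)
    from continuous_on_compose2[OF this continuous_on_matrix_inv[OF K(3,1)]]
    have "continuous_on K (\<lambda>k. l (gauss_on M (\<lambda>m. q (matrix_inv k *v m))))" by simp
    then show ?thesis
      by (rule continuous_on_eq) (simp add: q(2) translate_gauss)
  qed
  then show ?thesis
    unfolding B(4)[symmetric]
    by (intro fscale.continuous_map_action B linear_translate)
      (use span_orbit_invariant B(4) in auto)
qed

lemma limitin_orbit: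
  assumes Y: "Y \<in> lie_algebra K" and v: "v \<in> P"
  shows "limitin (fscale.weak (fscale.span (orbit v)))
    (\<lambda>t::real. fscale (1 / complex_of_real t) (translate (mexp (t *\<^sub>R Y)) v - v)) (dpi M Y v) (at 0)"
proof -
  obtain p where p: "polynomial_function p" "v = gauss_on M p" using v by (rule P_cases)
  obtain B where B: "B \<subseteq> orbit v" "finite B" "fscale.independent B" "fscale.span B = fscale.span (orbit v)"
    using orbit_basis[OF v] .
  have YG: "Y \<in> lie_algebra G" using Y lie_algebra_K_G by blast
  have mexp_K: "mexp (t *\<^sub>R Y) \<in> K" for t
    using Y by (simp add: lie_algebra_def)
  let ?g = "\<lambda>t::real. fscale (1 / complex_of_real t) (translate (mexp (t *\<^sub>R Y)) v - v)"
  have tv: "translate (mexp (t *\<^sub>R Y)) v = gauss_on M (\<lambda>m. p (mexp (t *\<^sub>R - Y) *v m))" for t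
    using mexp_K[of t] by (simp add: p(2) translate_gauss matrix_inv_mexp)
  have dv: "dpi M Y v = gauss_on M (gauss_deriv Y p)"
    unfolding p(2) by (rule dpi_gauss[OF YG p(1)])
  have quotient: "l (?g t) = (1 / t) *\<^sub>R (l (translate (mexp (t *\<^sub>R Y)) v) - l (translate (mexp (0 *\<^sub>R Y)) v))"
    if "fscale.functional l" for l t
  proof -
    interpret l: Vector_Spaces.linear fscale "(*)" l by (rule that)
    have "translate (mexp (0 *\<^sub>R Y)) v = v" unfolding tv by (simp add: p(2))
    then show ?thesis by (simp only: l.scale l.diff scaleR_conv_of_real) simp
  qed
  have lim: "\<exists>c. ((\<lambda>t. l (?g t)) \<longlongrightarrow> c) (at 0)" if l: "fscale.functional l" for l
  proof -
    let ?h = "\<lambda>A. l (gauss_on M (\<lambda>m. p (A *v m)))"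
    have "(?h has_derivative frechet_derivative ?h (at (mexp (0 *\<^sub>R - Y)))) (at (mexp (0 *\<^sub>R - Y)))"
      by (rule frechet_derivative_works[THEN iffD1, OF functional_orbit_differentiable[OF l p(1)]])
    from vector_derivative_diff_chain_within[OF mexp_scaleR_has_vector_derivative has_derivative_at_withinI[OF this]]
    obtain c where "((\<lambda>t. ?h (mexp (t *\<^sub>R - Y))) has_vector_derivative c) (at 0)"
      unfolding o_def by blast
    from has_vector_derivative_imp_quotient_tendsto[OF this]
    have "((\<lambda>t. l (?g t)) \<longlongrightarrow> c) (at 0)"
      unfolding quotient[OF l] unfolding tv .
    then show ?thesis ..
  qed
  have ev: "((\<lambda>t. ?g t x) \<longlongrightarrow> dpi M Y v x) (at 0)" for x
  proof -
    have "((\<lambda>t. gauss_on M (\<lambda>m. p (mexp (t *\<^sub>R - Y) *v m)) x) has_vector_derivative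
        gauss_on M (gauss_deriv Y p) x) (at 0)"
    proof (cases "x \<in> M")
      case True
      have "gauss_on M (\<lambda>m. p (mexp (t *\<^sub>R - Y) *v m)) x = gauss p (mexp (t *\<^sub>R - Y) *v x)" for t
      proof -
        have "mexp (t *\<^sub>R - Y) \<in> K" using mexp_K[of "- t"] by simp
        then show ?thesis using True invariant by (simp add: gauss_on_def gauss_def)
      qed
      then show ?thesis
        using gauss_flow_has_vector_derivative[OF p(1), of Y x 0] True by (simp add: gauss_on_def)
    qed (simp add: gauss_on_def)
    from has_vector_derivative_imp_quotient_tendsto[OF this]
    show ?thesis
      unfolding quotient[OF linear_evaluation] dv unfolding tv .
  qed
  have "limitin (fscale.weak (fscale.span B)) ?g (dpi M Y v) (at 0)"
  proof (rule fscale.limitin_weak_of_functionals[OF B(2,3) _ lim, where L="range (\<lambda>x v. v x)"])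
    have "?g t \<in> fscale.span (orbit v)" for t
    proof (intro fscale.span_scale fscale.span_diff fscale.span_base)
      show "translate (mexp (t *\<^sub>R Y)) v \<in> orbit v" using mexp_K by blast
      have "translate (mexp (0 *\<^sub>R Y)) v = v" unfolding tv by (simp add: p(2))
      then show "v \<in> orbit v" using mexp_K[of 0] by (metis imageI)
    qed
    then show "\<forall>\<^sub>F t in at 0. ?g t \<in> fscale.span B" by (simp add: B(4))
    show "w = dpi M Y v" if "\<And>l. l \<in> range (\<lambda>x v. v x) \<Longrightarrow> l w = l (dpi M Y v)" for w
      using that by (auto simp: fun_eq_iff)
  qed (use ev linear_evaluation in auto)
  then show ?thesis by (simp add: B(4))
qed

lemma gK_module_P: "gK_module fscale (lie_algebra G) K P (dpi M) translate"
proof (intro gK_module.intro gK_module_axioms.intro)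
  show "vector_space fscale" ..
  show "fscale.subspace P"
  proof (rule fscale.subspaceI)
    have "gauss_on M (\<lambda>_. 0) = 0"
      by (simp add: gauss_on_def gauss_def fun_eq_iff)
    then show "0 \<in> P"
      using P_I[of "\<lambda>_. 0"] by simp
    show "v + w \<in> P" if "v \<in> P" "w \<in> P" for v w
      using that by (auto elim!: P_cases simp flip: gauss_on_add intro!: P_I)
    show "fscale c v \<in> P" if "v \<in> P" for c v
      using that by (auto elim!: P_cases simp flip: gauss_on_cmult intro!: P_I)
  qed
next
  fix X assume X: "X \<in> lie_algebra G"
  show "complex_linear_on fscale P (dpi M X)"
    unfolding complex_linear_on_def
  proof (intro conjI ballI allI)
    show "dpi M X ` P \<subseteq> P" using dpi_P[OF X] by blast
    fix v assume "v \<in> P"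
    then obtain p where p: "polynomial_function p" "v = gauss_on M p" by (rule P_cases)
    show "dpi M X (fscale c v) = fscale c (dpi M X v)" for c
    proof -
      have "polynomial_function (\<lambda>m. c * p m)" using p(1) by auto
      then have "dpi M X (gauss_on M (\<lambda>m. c * p m)) = gauss_on M (gauss_deriv X (\<lambda>m. c * p m))"
        by (rule dpi_gauss[OF X])
      then show ?thesis by (simp add: p gauss_deriv_cmult dpi_gauss[OF X] gauss_on_cmult)
    qed
    fix w assume "w \<in> P"
    then obtain q where q: "polynomial_function q" "w = gauss_on M q" by (rule P_cases)
    have "dpi M X (gauss_on M (\<lambda>m. p m + q m)) = gauss_on M (gauss_deriv X (\<lambda>m. p m + q m))"
      using p(1) q(1) by (intro dpi_gauss[OF X]) auto
    then show "dpi M X (v + w) = dpi M X v + dpi M X w"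
      by (simp add: p q gauss_deriv_add dpi_gauss[OF X] gauss_on_add)
  qed
  show "dpi M (t *\<^sub>R X) v = fscale (complex_of_real t) (dpi M X v)" if "v \<in> P" for t v
  proof -
    obtain p where p: "polynomial_function p" "v = gauss_on M p" using \<open>v \<in> P\<close> by (rule P_cases)
    show ?thesis
      using X p by (simp add: dpi_gauss lie_algebra_scaleR[OF subgroup_G] gauss_deriv_field gauss_on_cmult)
  qed
  fix Y assume Y: "Y \<in> lie_algebra G"
  fix v assume "v \<in> P"
  then obtain p where p: "polynomial_function p" "v = gauss_on M p" by (rule P_cases)
  show "dpi M (X + Y) v = dpi M X v + dpi M Y v"
    using X Y p by (simp add: dpi_gauss lie_algebra_add[OF G] gauss_deriv_field gauss_on_add)
  have "gauss_deriv (lie_bracket X Y) p = (\<lambda>m. gauss_deriv X (gauss_deriv Y p) m - gauss_deriv Y (gauss_deriv X p) m)"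
    using gauss_deriv_bracket[OF p(1)] by (rule ext)
  then show "dpi M (lie_bracket X Y) v = dpi M X (dpi M Y v) - dpi M Y (dpi M X v)"
    using X Y p by (simp add: dpi_gauss lie_algebra_bracket[OF G] polynomial_function_gauss_deriv
        gauss_on_diff)
next
  fix k assume k: "k \<in> K"
  then have inv: "invertible k" by (rule subgroup_GL_invertible[OF K(1)])
  have kM: "k *v m \<in> M \<longleftrightarrow> m \<in> M" for m
    using k K(2) by (intro action_iff) auto
  show "complex_linear_on fscale P (translate k)"
    unfolding complex_linear_on_def using translate_P[OF k]
    by (auto simp: translate_def fscale_def)
  show "translate k (dpi M X v) = dpi M (Ad k X) (translate k v)"
    if X: "X \<in> lie_algebra G" and v: "v \<in> P" for X v
  proof -
    obtain p where p: "polynomial_function p" "v = gauss_on M p" using v by (rule P_cases)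
    have "has_dpi M (Ad k X) (translate k v) (translate k (dpi M X v))"
      unfolding p(2) dpi_gauss[OF X p(1)]
      by (rule has_dpi_translate[OF inv kM gauss_has_dpi[OF X p(1)]])
    moreover have "translate k v \<in> C0 M"
      unfolding p(2) by (rule translate_C0[OF inv kM gauss_on_C0[OF M p(1)]])
    ultimately show ?thesis by (simp add: dpi_eqI)
  qed
next
  fix v assume v: "v \<in> P"
  have "matrix_inv (mat 1 :: real^'n^'n) = mat 1" by (rule matrix_inv_eqI) simp_all
  then show "translate (mat 1) v = v" by (simp add: translate_def)
  show "\<exists>B. finite B \<and> fscale.span B = fscale.span (orbit v)"
    using orbit_basis[OF v] by metis
qed (use translate_mult continuous_map_orbit limitin_orbit in auto)

end

theorem lemma2:
  fixes G K :: "(real^'n^'n) set" and M :: "(real^'n) set"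
  assumes "real_linear_algebraic_group G"
    and "\<forall>g\<in>G. transpose g \<in> G"
    and "maximal_compact_subgroup K G"
    and "smooth_affine_variety M"
    and "\<forall>g\<in>G. \<forall>m\<in>M. g *v m \<in> M"
    and "\<forall>k\<in>K. \<forall>m\<in>M. r2 (k *v m) = r2 m"
  shows "gauss_polynomials M \<subseteq> C0 M \<and>
    (\<forall>X\<in>lie_algebra G. \<forall>\<phi>\<in>gauss_polynomials M. \<exists>\<psi>. has_dpi M X \<phi> \<psi>) \<and>
    gK_module fscale (lie_algebra G) K (gauss_polynomials M) (dpi M) translate"
proof -
  interpret affine_action G K M
    by (rule affine_action.intro) (use assms in
      \<open>auto simp: maximal_compact_subgroup_def smooth_affine_variety_def closed_algebraic_set\<close>)
  have "gauss_polynomials M \<subseteq> C0 M"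
    by (auto elim!: P_cases intro: gauss_on_C0[OF M])
  moreover have "\<exists>\<psi>. has_dpi M X \<phi> \<psi>" if "X \<in> lie_algebra G" "\<phi> \<in> gauss_polynomials M" for X \<phi>
    using that(2) by (rule P_cases) (use gauss_has_dpi[OF that(1)] in blast)
  ultimately show ?thesis using gK_module_P by blast
qed

end
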